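(* Let $(M',g',Q)$ be an $\varepsilon$-quaternionic Kähler manifold in the image of the $\varepsilon$-HK/QK correspondence (as described in the context). Then the globally defined almost $\epsilon_1$-complex structure $J_1'\in\Gamma(Q)$ is integrable.
   Context: Conventions. $\varepsilon\in\{-1,1\}$; $(\epsilon_1,\epsilon_2,\epsilon_3)$ is a permutation of $(-1,\varepsilon,\varepsilon)$, so $\epsilon_3=-\epsilon_1\epsilon_2$. An almost $\epsilon_1$-complex structure is an almost complex structure if $\epsilon_1=-1$ and an almost para-complex structure ($J^2=\mathrm{Id}$, with $\pm1$-eigendistributions of equal rank) if $\epsilon_1=1$; integrable means that it comes from a complex, respectively para-complex, manifold structure (equivalently, its Nijenhuis tensor vanishes). $\varepsilon$-hyper-Kähler manifold: a pseudo-Riemannian manifold $(M,g)$ with $g$-skew-symmetric endomorphism fields $J_1,J_2,J_3\in\Gamma(\mathrm{End}\,TM)$ with $J_\alpha^2=\epsilon_\alpha \mathrm{Id}$ ($\alpha=1,2,3$), $J_1J_2=J_3$, and such that the two-forms $\omega_\alpha:=-\epsilon_\alpha g(J_\alpha\cdot,\cdot)$ are closed. One has $J_\alpha J_\beta=-J_\beta J_\alpha=\epsilon_3\epsilon_\gamma J_\gamma$ for $(\alpha,\beta,\gamma)$ cyclic. The $\varepsilon$-HK/QK correspondence. Input: an $\varepsilon$-hyper-Kähler manifold $(M,g,J_1,J_2,J_3)$ and $f\in C^\infty(M)$ such that the vector field $Z:=-\omega_1^{-1}(df)$, i.e. $\omega_1(Z,\cdot)=-df$, is timelike or spacelike ($g(Z,Z)$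 nowhere zero), Killing, and satisfies $\mathcal L_ZJ_1=0$, $\mathcal L_ZJ_2=2\epsilon_1J_3$. Put $f_1:=f-\tfrac12 g(Z,Z)$, $\beta:=g(Z,\cdot)$; $\mathrm{sign}\,f$ and $\mathrm{sign}\,f_1$ are assumed constant and non-vanishing. Let $\pi:P\to M$ be a rank-one principal bundle (one-dimensional abelian structure group, such as $\mathbb R$ or $S^1$, with Lie algebra identified with $\mathbb R$) with principal connection $\eta\in\Omega^1(P)$ with curvature $d\eta=\pi^*(\omega_1-\tfrac12d\beta)$. $X_P$ is the fundamental vector field normalised by $\eta(X_P)=1$, and $\tilde Y\in\Gamma(\ker\eta)$ is the horizontal lift of a vector field $Y$ on $M$. Pull-backs of $f,f_1,\beta$ to $P$ are denoted by the same symbols. Put $$g_P:=\tfrac{2}{f_1}\eta^2+\pi^*g,\qquad Z_1^P:=\tilde Z+f_1X_P,$$ $$\theta_0^P:=\tfrac12df,\quad \theta_1^P:=\eta+\tfrac12\beta,\quad \theta_2^P:=-\tfrac{\epsilon_2}{2}\pi^*\omega_3(Z,\cdot),\quad \theta_3^P:=\tfrac{\epsilon_2}{2}\pi^*\omega_2(Z,\cdot).$$ Let $M'\subset P$ be a codimension-one submanifold with $TP|_{M'}=TM'\oplus\mathbb R Z_1^P$, and $pr_{TM'}$ the projection $TP|_{M'}\to TM'$ along $Z_1^P$. Set $X:=pr_{TM'}\circ X_P|_{M'}$ and, for a vector field $Y$ on $M$, $Y':=pr_{TM'}\circ\tilde Y|_{M'}$ (so $X=-\tfrac1{f_1}Z'$).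 Let $\mathcal D^v:=\mathrm{span}\{Z,J_1Z,J_2Z,J_3Z\}$, $\mathcal D^h:=(\mathcal D^v)^{\perp_g}\subset TM$. The endomorphism fields $J'_\alpha$ of $TM'$ are the unique ones with $J_\alpha'^2=\epsilon_\alpha\mathrm{Id}$, $J_1'J_2'=J_3'$ and $$J'_\alpha X=-\tfrac{1}{f_1}(J_\alpha Z)',\qquad J'_\alpha(J_\beta Z)'=\epsilon_3\epsilon_\gamma(J_\gamma Z)'\ \text{ for }(\alpha,\beta,\gamma)\text{ cyclic},\qquad J'_\alpha(Y')=(J_\alpha Y)'\ \text{ for }Y\in\Gamma(\mathcal D^h).$$ Output: $(M',g',Q)$ with $Q:=\mathrm{span}\{J_1',J_2',J_3'\}$ and $$g' := \left.\frac{1}{2|f|}\left(g_P-\frac{2}{f}\left((\theta_1^P)^2-\epsilon_1(\theta_0^P)^2-\epsilon_2(\theta_3^P)^2-\epsilon_3(\theta_2^P)^2\right)\right)\right|_{M'},$$ which is an $\varepsilon$-quaternionic Kähler manifold (a pseudo-Riemannian manifold of non-zero scalar curvature with parallel rank-three bundle $Q$ of skew-symmetric endomorphisms locally spanned by $J'_1,J'_2,J'_3$ satisfying $J_1'^2=\epsilon_1\mathrm{Id}$, $J_2'^2=\epsilon_2\mathrm{Id}$, $J_3'^2=\epsilon_3\mathrm{Id}$, $J_1'J_2'=J_3'$; in dimension 4 one requires additionally that the curvature tensor is the sum of a constant multiple of that of (para-)quaternionic projective space and a trace-free $Q$-invariant algebraic curvature tensor). *)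

theory Defs
  imports "HOL-Analysis.Analysis" "HOL-Algebra.Group"
begin

section \<open>Smooth manifolds\<close>

primrec Ck_on :: "nat \<Rightarrow> 'a::euclidean_space set \<Rightarrow> ('a \<Rightarrow> 'b::real_normed_vector) \<Rightarrow> bool" where
  "Ck_on 0 = (\<lambda>S f. continuous_on S f)"
| "Ck_on (Suc k) = (\<lambda>S f. (\<forall>x\<in>S. f differentiable (at x)) \<and>
      (\<forall>v. Ck_on k S (\<lambda>x. frechet_derivative f (at x) v)))"

text \<open>Only meant for open \<open>S\<close>.\<close>

definition smooth_on :: "'a::euclidean_space set \<Rightarrow> ('a \<Rightarrow> 'b::real_normed_vector) \<Rightarrow> bool" where
  "smooth_on S f \<longleftrightarrow> (\<forall>k. Ck_on k S f)"

type_synonym ('a, 'e) chart = "'a set \<times> ('a \<Rightarrow> 'e)"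

record ('a, 'e) mfd =
  mtop :: "'a topology"
  atlas :: "('a, 'e) chart set"

abbreviation mpoints :: "('a, 'e, 'z) mfd_scheme \<Rightarrow> 'a set" where
  "mpoints M \<equiv> topspace (mtop M)"

abbreviation cinv :: "('a, 'e) chart \<Rightarrow> 'e \<Rightarrow> 'a" where
  "cinv c \<equiv> inv_into (fst c) (snd c)"

text \<open>The atlas need not be maximal; the dimension is that of the model space \<open>'e\<close>.\<close>

definition smooth_manifold :: "('a, 'e::euclidean_space) mfd \<Rightarrow> bool" where
  "smooth_manifold M \<longleftrightarrow>
     Hausdorff_space (mtop M) \<and> second_countable (mtop M) \<and>
     (\<forall>c\<in>atlas M. openin (mtop M) (fst c) \<and> open (snd c ` fst c) \<and>
        homeomorphic_map (subtopology (mtop M) (fst c)) (top_of_set (snd c ` fst c)) (snd c)) \<and>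
     (\<Union>c\<in>atlas M. fst c) = mpoints M \<and>
     (\<forall>c\<in>atlas M. \<forall>d\<in>atlas M. smooth_on (snd c ` (fst c \<inter> fst d)) (snd d \<circ> cinv c))"

definition prod_mfd :: "('a, 'e) mfd \<Rightarrow> ('b, 'f) mfd \<Rightarrow> ('a \<times> 'b, 'e \<times> 'f) mfd" where
  "prod_mfd M N = \<lparr> mtop = prod_topology (mtop M) (mtop N),
     atlas = {(fst c \<times> fst d, map_prod (snd c) (snd d)) | c d. c \<in> atlas M \<and> d \<in> atlas N} \<rparr>"

definition smooth_map_on ::
  "('a, 'e::euclidean_space) mfd \<Rightarrow> ('b, 'f::euclidean_space) mfd \<Rightarrow> 'a set \<Rightarrow> ('a \<Rightarrow> 'b) \<Rightarrow> bool" where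
  "smooth_map_on M N U F \<longleftrightarrow> openin (mtop M) U \<and>
     continuous_map (subtopology (mtop M) U) (mtop N) F \<and>
     (\<forall>c\<in>atlas M. \<forall>d\<in>atlas N.
        smooth_on (snd c ` {p \<in> U \<inter> fst c. F p \<in> fst d}) (snd d \<circ> F \<circ> cinv c))"

definition smooth_fun :: "('a, 'e::euclidean_space) mfd \<Rightarrow> ('a \<Rightarrow> real) \<Rightarrow> bool" where
  "smooth_fun M h \<longleftrightarrow> (\<forall>c\<in>atlas M. smooth_on (snd c ` fst c) (h \<circ> cinv c))"

section \<open>Tangent vectors and tensor fields\<close>

text \<open>The tangent space at \<open>p\<close> is identified with the model space \<open>'e\<close> by means of a fixed chart
  \<open>chart_at M p\<close> around \<open>p\<close>, chosen once and for all for every point. Thus a vector field is a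
  function \<open>'a \<Rightarrow> 'e\<close>, an endomorphism field a function \<open>'a \<Rightarrow> 'e \<Rightarrow> 'e\<close>, etc. As the chart depends
  on the point in an arbitrary way, smoothness of such fields, and every derivative of them, refers
  to their components with respect to one chart on the whole of its domain; the translation between
  the two is done by \<open>to_chart\<close> and \<open>of_chart\<close>.\<close>

definition chart_at :: "('a, 'e) mfd \<Rightarrow> 'a \<Rightarrow> ('a, 'e) chart" where
  "chart_at M p = (SOME c. c \<in> atlas M \<and> p \<in> fst c)"

definition tchange ::
  "('a, 'e::euclidean_space) chart \<Rightarrow> ('a, 'e) chart \<Rightarrow> 'a \<Rightarrow> 'e \<Rightarrow> 'e" where
  "tchange c d p = frechet_derivative (snd d \<circ> cinv c) (at (snd c p))"

definition to_chart ::
  "('a, 'e::euclidean_space) mfd \<Rightarrow> ('a, 'e) chart \<Rightarrow> 'a \<Rightarrow> 'e \<Rightarrow> 'e" where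
  "to_chart M c p = tchange (chart_at M p) c p"

definition of_chart ::
  "('a, 'e::euclidean_space) mfd \<Rightarrow> ('a, 'e) chart \<Rightarrow> 'a \<Rightarrow> 'e \<Rightarrow> 'e" where
  "of_chart M c p = tchange c (chart_at M p) p"

definition smooth_vector_field :: "('a, 'e::euclidean_space) mfd \<Rightarrow> ('a \<Rightarrow> 'e) \<Rightarrow> bool" where
  "smooth_vector_field M X \<longleftrightarrow>
     (\<forall>c\<in>atlas M. smooth_on (snd c ` fst c) (\<lambda>x. to_chart M c (cinv c x) (X (cinv c x))))"

definition smooth_one_form :: "('a, 'e::euclidean_space) mfd \<Rightarrow> ('a \<Rightarrow> 'e \<Rightarrow> real) \<Rightarrow> bool" where
  "smooth_one_form M \<beta> \<longleftrightarrow> (\<forall>p\<in>mpoints M. linear (\<beta> p)) \<and>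
     (\<forall>c\<in>atlas M. \<forall>a. smooth_on (snd c ` fst c) (\<lambda>x. \<beta> (cinv c x) (of_chart M c (cinv c x) a)))"

definition smooth_endo_field_on ::
  "('a, 'e::euclidean_space) mfd \<Rightarrow> 'a set \<Rightarrow> ('a \<Rightarrow> 'e \<Rightarrow> 'e) \<Rightarrow> bool" where
  "smooth_endo_field_on M U J \<longleftrightarrow> openin (mtop M) U \<and> (\<forall>p\<in>U. linear (J p)) \<and>
     (\<forall>c\<in>atlas M. \<forall>a. smooth_on (snd c ` (U \<inter> fst c))
        (\<lambda>x. to_chart M c (cinv c x) (J (cinv c x) (of_chart M c (cinv c x) a))))"

definition pseudo_riemannian ::
  "('a, 'e::euclidean_space) mfd \<Rightarrow> ('a \<Rightarrow> 'e \<Rightarrow> 'e \<Rightarrow> real) \<Rightarrow> bool" where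
  "pseudo_riemannian M g \<longleftrightarrow>
     (\<forall>p\<in>mpoints M. bilinear (g p) \<and> (\<forall>u v. g p u v = g p v u) \<and>
        (\<forall>u. (\<forall>v. g p u v = 0) \<longrightarrow> u = 0)) \<and>
     (\<forall>c\<in>atlas M. \<forall>a b. smooth_on (snd c ` fst c)
        (\<lambda>x. g (cinv c x) (of_chart M c (cinv c x) a) (of_chart M c (cinv c x) b)))"

definition dfun :: "('a, 'e::euclidean_space) mfd \<Rightarrow> ('a \<Rightarrow> real) \<Rightarrow> 'a \<Rightarrow> 'e \<Rightarrow> real" where
  "dfun M h p = frechet_derivative (h \<circ> cinv (chart_at M p)) (at (snd (chart_at M p) p))"

definition tmap ::
  "('a, 'e::euclidean_space) mfd \<Rightarrow> ('b, 'f::euclidean_space) mfd \<Rightarrow> ('a \<Rightarrow> 'b) \<Rightarrow> 'a \<Rightarrow> 'e \<Rightarrow> 'f" where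
  "tmap M N F p = frechet_derivative (snd (chart_at N (F p)) \<circ> F \<circ> cinv (chart_at M p))
     (at (snd (chart_at M p) p))"

definition lie_bracket ::
  "('a, 'e::euclidean_space) mfd \<Rightarrow> ('a \<Rightarrow> 'e) \<Rightarrow> ('a \<Rightarrow> 'e) \<Rightarrow> 'a \<Rightarrow> 'e" where
  "lie_bracket M X Y p =
     (let c = chart_at M p;
          X' = (\<lambda>x. to_chart M c (cinv c x) (X (cinv c x)));
          Y' = (\<lambda>x. to_chart M c (cinv c x) (Y (cinv c x)))
      in frechet_derivative Y' (at (snd c p)) (X' (snd c p))
         - frechet_derivative X' (at (snd c p)) (Y' (snd c p)))"

text \<open>The vector field on the domain of \<open>chart_at M p\<close> with constant components and value \<open>v\<close> at
  \<open>p\<close>. Below, tensors are obtained by evaluating the usual coordinate-free formulas on such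
  extensions of the given tangent vectors.\<close>

definition local_ext :: "('a, 'e::euclidean_space) mfd \<Rightarrow> 'a \<Rightarrow> 'e \<Rightarrow> 'a \<Rightarrow> 'e" where
  "local_ext M p v = (\<lambda>q. of_chart M (chart_at M p) q v)"

definition ext_d1 ::
  "('a, 'e::euclidean_space) mfd \<Rightarrow> ('a \<Rightarrow> 'e \<Rightarrow> real) \<Rightarrow> 'a \<Rightarrow> 'e \<Rightarrow> 'e \<Rightarrow> real" where
  "ext_d1 M \<beta> p u v =
     (let U = local_ext M p u; V = local_ext M p v in
      dfun M (\<lambda>q. \<beta> q (V q)) p u - dfun M (\<lambda>q. \<beta> q (U q)) p v - \<beta> p (lie_bracket M U V p))"

definition ext_d2 ::
  "('a, 'e::euclidean_space) mfd \<Rightarrow> ('a \<Rightarrow> 'e \<Rightarrow> 'e \<Rightarrow> real) \<Rightarrow> 'a \<Rightarrow> 'e \<Rightarrow> 'e \<Rightarrow> 'e \<Rightarrow> real" where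
  "ext_d2 M \<omega> p u v w =
     (let U = local_ext M p u; V = local_ext M p v; W = local_ext M p w in
      dfun M (\<lambda>q. \<omega> q (V q) (W q)) p u - dfun M (\<lambda>q. \<omega> q (U q) (W q)) p v
      + dfun M (\<lambda>q. \<omega> q (U q) (V q)) p w
      - \<omega> p (lie_bracket M U V p) w + \<omega> p (lie_bracket M U W p) v - \<omega> p (lie_bracket M V W p) u)"

definition lie_bilinear_form ::
  "('a, 'e::euclidean_space) mfd \<Rightarrow> ('a \<Rightarrow> 'e) \<Rightarrow> ('a \<Rightarrow> 'e \<Rightarrow> 'e \<Rightarrow> real) \<Rightarrow> 'a \<Rightarrow> 'e \<Rightarrow> 'e \<Rightarrow> real" where
  "lie_bilinear_form M Z B p u v =
     (let U = local_ext M p u; V = local_ext M p v in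
      dfun M (\<lambda>q. B q (U q) (V q)) p (Z p) - B p (lie_bracket M Z U p) v - B p u (lie_bracket M Z V p))"

definition lie_endo ::
  "('a, 'e::euclidean_space) mfd \<Rightarrow> ('a \<Rightarrow> 'e) \<Rightarrow> ('a \<Rightarrow> 'e \<Rightarrow> 'e) \<Rightarrow> 'a \<Rightarrow> 'e \<Rightarrow> 'e" where
  "lie_endo M Z J p v =
     (let V = local_ext M p v in
      lie_bracket M Z (\<lambda>q. J q (V q)) p - J p (lie_bracket M Z V p))"

definition killing ::
  "('a, 'e::euclidean_space) mfd \<Rightarrow> ('a \<Rightarrow> 'e \<Rightarrow> 'e \<Rightarrow> real) \<Rightarrow> ('a \<Rightarrow> 'e) \<Rightarrow> bool" where
  "killing M g Z \<longleftrightarrow> (\<forall>p\<in>mpoints M. \<forall>u v. lie_bilinear_form M Z g p u v = 0)"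

definition nijenhuis ::
  "('a, 'e::euclidean_space) mfd \<Rightarrow> ('a \<Rightarrow> 'e \<Rightarrow> 'e) \<Rightarrow> 'a \<Rightarrow> 'e \<Rightarrow> 'e \<Rightarrow> 'e" where
  "nijenhuis M J p u v =
     (let U = local_ext M p u; V = local_ext M p v;
          JU = (\<lambda>q. J q (U q)); JV = (\<lambda>q. J q (V q)) in
      lie_bracket M JU JV p - J p (lie_bracket M JU V p) - J p (lie_bracket M U JV p)
      + J p (J p (lie_bracket M U V p)))"

definition almost_eps_complex ::
  "('a, 'e::euclidean_space) mfd \<Rightarrow> real \<Rightarrow> ('a \<Rightarrow> 'e \<Rightarrow> 'e) \<Rightarrow> bool" where
  "almost_eps_complex M e J \<longleftrightarrow> smooth_endo_field_on M (mpoints M) J \<and>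
     (\<forall>p\<in>mpoints M. (\<forall>v. J p (J p v) = e *\<^sub>R v) \<and>
        (e = 1 \<longrightarrow> dim {v. J p v = v} = dim {v. J p v = - v}))"

text \<open>Integrability is understood as vanishing of the Nijenhuis tensor; that this is equivalent to the
  existence of an underlying (para-)complex manifold structure is the Newlander-Nirenberg theorem in
  the complex case and the Frobenius theorem in the para-complex case.\<close>

definition integrable_structure ::
  "('a, 'e::euclidean_space) mfd \<Rightarrow> ('a \<Rightarrow> 'e \<Rightarrow> 'e) \<Rightarrow> bool" where
  "integrable_structure M J \<longleftrightarrow> (\<forall>p\<in>mpoints M. \<forall>u v. nijenhuis M J p u v = 0)"

section \<open>Levi-Civita connection and curvature\<close>

text \<open>\<open>levi_civita M g V p u\<close> is the covariant derivative at \<open>p\<close>, in direction \<open>u\<close>, of the vector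
  field \<open>V\<close> (defined near \<open>p\<close>), characterised by the Koszul formula.\<close>

definition levi_civita ::
  "('a, 'e::euclidean_space) mfd \<Rightarrow> ('a \<Rightarrow> 'e \<Rightarrow> 'e \<Rightarrow> real) \<Rightarrow> ('a \<Rightarrow> 'e) \<Rightarrow> 'a \<Rightarrow> 'e \<Rightarrow> 'e" where
  "levi_civita M g V p u = (THE z. \<forall>w.
     (let U = local_ext M p u; W = local_ext M p w in
      2 * g p z w =
        dfun M (\<lambda>q. g q (V q) (W q)) p u + dfun M (\<lambda>q. g q (U q) (W q)) p (V p)
        - dfun M (\<lambda>q. g q (U q) (V q)) p w
        + g p (lie_bracket M U V p) w - g p (lie_bracket M U W p) (V p)
        - g p (lie_bracket M V W p) u))"

definition nabla_endo ::
  "('a, 'e::euclidean_space) mfd \<Rightarrow> ('a \<Rightarrow> 'e \<Rightarrow> 'e \<Rightarrow> real) \<Rightarrow> ('a \<Rightarrow> 'e \<Rightarrow> 'e) \<Rightarrow> 'a \<Rightarrow> 'e \<Rightarrow> 'e \<Rightarrow> 'e" where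
  "nabla_endo M g A p u v =
     (let V = local_ext M p v in
      levi_civita M g (\<lambda>q. A q (V q)) p u - A p (levi_civita M g V p u))"

definition curvature ::
  "('a, 'e::euclidean_space) mfd \<Rightarrow> ('a \<Rightarrow> 'e \<Rightarrow> 'e \<Rightarrow> real) \<Rightarrow> 'a \<Rightarrow> 'e \<Rightarrow> 'e \<Rightarrow> 'e \<Rightarrow> 'e" where
  "curvature M g p u v w =
     (let U = local_ext M p u; V = local_ext M p v; W = local_ext M p w in
      levi_civita M g (\<lambda>q. levi_civita M g W q (V q)) p u
      - levi_civita M g (\<lambda>q. levi_civita M g W q (U q)) p v
      - levi_civita M g W p (lie_bracket M U V p))"

definition endo_trace :: "('e::euclidean_space \<Rightarrow> 'e) \<Rightarrow> real" where
  "endo_trace A = (\<Sum>b\<in>Basis. A b \<bullet> b)"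

definition ricci :: "('e::euclidean_space \<Rightarrow> 'e \<Rightarrow> 'e \<Rightarrow> 'e) \<Rightarrow> 'e \<Rightarrow> 'e \<Rightarrow> real" where
  "ricci R v w = endo_trace (\<lambda>u. R u v w)"

definition scalar_curvature ::
  "('a, 'e::euclidean_space) mfd \<Rightarrow> ('a \<Rightarrow> 'e \<Rightarrow> 'e \<Rightarrow> real) \<Rightarrow> 'a \<Rightarrow> real" where
  "scalar_curvature M g p =
     endo_trace (\<lambda>v. THE z. \<forall>w. g p z w = ricci (curvature M g p) v w)"

definition algebraic_curvature ::
  "('e::euclidean_space \<Rightarrow> 'e \<Rightarrow> real) \<Rightarrow> ('e \<Rightarrow> 'e \<Rightarrow> 'e \<Rightarrow> 'e) \<Rightarrow> bool" where
  "algebraic_curvature B R \<longleftrightarrow>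
     (\<forall>u v. linear (R u v)) \<and> (\<forall>v w. linear (\<lambda>u. R u v w)) \<and>
     (\<forall>u v w. R u v w = - R v u w) \<and>
     (\<forall>u v w z. B (R u v w) z = - B w (R u v z)) \<and>
     (\<forall>u v w. R u v w + R v w u + R w u v = 0)"

section \<open>Quaternionic structures\<close>

text \<open>Triples \<open>(J\<^sub>1, J\<^sub>2, J\<^sub>3)\<close> and \<open>(\<epsilon>\<^sub>1, \<epsilon>\<^sub>2, \<epsilon>\<^sub>3)\<close> are represented by functions on \<open>nat\<close>, of which
  only the values at 1, 2, 3 matter.\<close>

definition eps_triple :: "real \<Rightarrow> (nat \<Rightarrow> real) \<Rightarrow> bool" where
  "eps_triple e \<epsilon> \<longleftrightarrow> e \<in> {-1, 1} \<and> (\<epsilon> 1, \<epsilon> 2, \<epsilon> 3) \<in> {(-1, e, e), (e, -1, e), (e, e, -1)}"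

definition cyclic3 :: "(nat \<times> nat \<times> nat) set" where
  "cyclic3 = {(1, 2, 3), (2, 3, 1), (3, 1, 2)}"

definition quaternionic_frame ::
  "(nat \<Rightarrow> real) \<Rightarrow> ('e::euclidean_space \<Rightarrow> 'e \<Rightarrow> real) \<Rightarrow> (nat \<Rightarrow> 'e \<Rightarrow> 'e) \<Rightarrow> bool" where
  "quaternionic_frame \<epsilon> B I \<longleftrightarrow>
     (\<forall>\<alpha>\<in>{1..3}. linear (I \<alpha>) \<and> (\<forall>v. I \<alpha> (I \<alpha> v) = \<epsilon> \<alpha> *\<^sub>R v) \<and>
        (\<forall>v w. B (I \<alpha> v) w = - B v (I \<alpha> w))) \<and>
     (\<forall>v. I 1 (I 2 v) = I 3 v)"

definition endo_span :: "(nat \<Rightarrow> 'e::euclidean_space \<Rightarrow> 'e) \<Rightarrow> ('e \<Rightarrow> 'e) set" where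
  "endo_span I = {A. \<exists>a :: nat \<Rightarrow> real. A = (\<lambda>v. \<Sum>\<alpha>\<in>{1..3}. a \<alpha> *\<^sub>R I \<alpha> v)}"

definition fundamental_form ::
  "(nat \<Rightarrow> real) \<Rightarrow> ('a \<Rightarrow> 'e \<Rightarrow> 'e \<Rightarrow> real) \<Rightarrow> (nat \<Rightarrow> 'a \<Rightarrow> 'e \<Rightarrow> 'e) \<Rightarrow> nat \<Rightarrow> 'a \<Rightarrow> 'e \<Rightarrow> 'e \<Rightarrow> real" where
  "fundamental_form \<epsilon> g J \<alpha> p u v = - \<epsilon> \<alpha> * g p (J \<alpha> p u) v"

definition eps_hyper_kaehler ::
  "(nat \<Rightarrow> real) \<Rightarrow> ('a, 'e::euclidean_space) mfd \<Rightarrow> ('a \<Rightarrow> 'e \<Rightarrow> 'e \<Rightarrow> real)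
     \<Rightarrow> (nat \<Rightarrow> 'a \<Rightarrow> 'e \<Rightarrow> 'e) \<Rightarrow> bool" where
  "eps_hyper_kaehler \<epsilon> M g J \<longleftrightarrow> smooth_manifold M \<and> pseudo_riemannian M g \<and>
     (\<forall>\<alpha>\<in>{1..3}. smooth_endo_field_on M (mpoints M) (J \<alpha>)) \<and>
     (\<forall>p\<in>mpoints M. quaternionic_frame \<epsilon> (g p) (\<lambda>\<alpha>. J \<alpha> p)) \<and>
     (\<forall>\<alpha>\<in>{1..3}. \<forall>p\<in>mpoints M. \<forall>u v w. ext_d2 M (fundamental_form \<epsilon> g J \<alpha>) p u v w = 0)"

text \<open>Up to a constant factor, the curvature tensor of (para-)quaternionic projective space.\<close>

definition proj_curvature ::
  "(nat \<Rightarrow> real) \<Rightarrow> ('e::euclidean_space \<Rightarrow> 'e \<Rightarrow> real) \<Rightarrow> (nat \<Rightarrow> 'e \<Rightarrow> 'e) \<Rightarrow> 'e \<Rightarrow> 'e \<Rightarrow> 'e \<Rightarrow> 'e" where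
  "proj_curvature \<epsilon> B I u v w = B v w *\<^sub>R u - B u w *\<^sub>R v
     - (\<Sum>\<alpha>\<in>{1..3}. \<epsilon> \<alpha> *\<^sub>R (B (I \<alpha> v) w *\<^sub>R I \<alpha> u - B (I \<alpha> u) w *\<^sub>R I \<alpha> v
          - (2 * B (I \<alpha> u) v) *\<^sub>R I \<alpha> w))"

definition eps_quaternionic_kaehler ::
  "(nat \<Rightarrow> real) \<Rightarrow> ('a, 'e::euclidean_space) mfd \<Rightarrow> ('a \<Rightarrow> 'e \<Rightarrow> 'e \<Rightarrow> real)
     \<Rightarrow> ('a \<Rightarrow> ('e \<Rightarrow> 'e) set) \<Rightarrow> bool" where
  "eps_quaternionic_kaehler \<epsilon> M g Q \<longleftrightarrow> smooth_manifold M \<and> pseudo_riemannian M g \<and>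
     (\<forall>p\<in>mpoints M. scalar_curvature M g p \<noteq> 0) \<and>
     (\<forall>p\<in>mpoints M. \<exists>U I. openin (mtop M) U \<and> p \<in> U \<and>
        (\<forall>\<alpha>\<in>{1..3}. smooth_endo_field_on M U (I \<alpha>)) \<and>
        (\<forall>q\<in>U. quaternionic_frame \<epsilon> (g q) (\<lambda>\<alpha>. I \<alpha> q) \<and> Q q = endo_span (\<lambda>\<alpha>. I \<alpha> q))) \<and>
     (\<forall>U A. smooth_endo_field_on M U A \<and> (\<forall>q\<in>U. A q \<in> Q q) \<longrightarrow>
        (\<forall>p\<in>U. \<forall>u. nabla_endo M g A p u \<in> Q p)) \<and>
     (DIM('e) = 4 \<longrightarrow> (\<exists>\<nu>. \<forall>p\<in>mpoints M. \<exists>I W.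
        quaternionic_frame \<epsilon> (g p) I \<and> Q p = endo_span I \<and>
        algebraic_curvature (g p) W \<and> (\<forall>v w. ricci W v w = 0) \<and>
        (\<forall>A\<in>Q p. \<forall>u v w. A (W u v w) - W (A u) v w - W u (A v) w - W u v (A w) = 0) \<and>
        (\<forall>u v w. curvature M g p u v w = \<nu> *\<^sub>R proj_curvature \<epsilon> (g p) I u v w + W u v w)))"

section \<open>Principal bundles of rank one\<close>

definition lie_group :: "('g, 'e::euclidean_space) mfd \<Rightarrow> 'g monoid \<Rightarrow> bool" where
  "lie_group G H \<longleftrightarrow> smooth_manifold G \<and> group H \<and> carrier H = mpoints G \<and>
     smooth_map_on (prod_mfd G G) G (mpoints G \<times> mpoints G) (\<lambda>(h, k). h \<otimes>\<^bsub>H\<^esub> k) \<and>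
     smooth_map_on G G (mpoints G) (\<lambda>h. inv\<^bsub>H\<^esub> h)"

definition principal_bundle ::
  "('g, 'f::euclidean_space) mfd \<Rightarrow> 'g monoid \<Rightarrow> ('p, 'h::euclidean_space) mfd \<Rightarrow> ('m, 'e::euclidean_space) mfd
     \<Rightarrow> ('p \<Rightarrow> 'm) \<Rightarrow> ('p \<Rightarrow> 'g \<Rightarrow> 'p) \<Rightarrow> bool" where
  "principal_bundle G H P M \<pi> act \<longleftrightarrow>
     lie_group G H \<and> smooth_manifold P \<and> smooth_manifold M \<and>
     smooth_map_on P M (mpoints P) \<pi> \<and> \<pi> ` mpoints P = mpoints M \<and>
     smooth_map_on (prod_mfd P G) P (mpoints P \<times> mpoints G) (\<lambda>(p, h). act p h) \<and>
     (\<forall>p\<in>mpoints P. act p \<one>\<^bsub>H\<^esub> = p \<and>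
        (\<forall>h\<in>carrier H. \<pi> (act p h) = \<pi> p \<and>
           (\<forall>k\<in>carrier H. act (act p h) k = act p (h \<otimes>\<^bsub>H\<^esub> k)))) \<and>
     (\<forall>x\<in>mpoints M. \<exists>U \<tau>. openin (mtop M) U \<and> x \<in> U \<and>
        bij_betw \<tau> {p \<in> mpoints P. \<pi> p \<in> U} (U \<times> mpoints G) \<and>
        smooth_map_on P (prod_mfd M G) {p \<in> mpoints P. \<pi> p \<in> U} \<tau> \<and>
        smooth_map_on (prod_mfd M G) P (U \<times> mpoints G) (inv_into {p \<in> mpoints P. \<pi> p \<in> U} \<tau>) \<and>
        (\<forall>p\<in>mpoints P. \<pi> p \<in> U \<longrightarrow> fst (\<tau> p) = \<pi> p \<and>
           (\<forall>h\<in>carrier H. snd (\<tau> (act p h)) = snd (\<tau> p) \<otimes>\<^bsub>H\<^esub> h)))"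

section \<open>The HK/QK correspondence\<close>

locale hk_data =
  fixes e :: real and \<epsilon> :: "nat \<Rightarrow> real"
    and M :: "('m, 'e::euclidean_space) mfd"
    and g :: "'m \<Rightarrow> 'e \<Rightarrow> 'e \<Rightarrow> real"
    and J :: "nat \<Rightarrow> 'm \<Rightarrow> 'e \<Rightarrow> 'e"
    and f :: "'m \<Rightarrow> real"
    and Z :: "'m \<Rightarrow> 'e"
  assumes eps: "eps_triple e \<epsilon>"
    and hyper_kaehler: "eps_hyper_kaehler \<epsilon> M g J"
    and f_smooth: "smooth_fun M f"
    and Z_smooth: "smooth_vector_field M Z"
    and Z_hamiltonian:
      "\<And>p v. p \<in> mpoints M \<Longrightarrow> fundamental_form \<epsilon> g J 1 p (Z p) v = - dfun M f p v"
    and Z_nonnull: "\<And>p. p \<in> mpoints M \<Longrightarrow> g p (Z p) (Z p) \<noteq> 0"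
    and Z_killing: "killing M g Z"
    and lie_J1: "\<And>p v. p \<in> mpoints M \<Longrightarrow> lie_endo M Z (J 1) p v = 0"
    and lie_J2: "\<And>p v. p \<in> mpoints M \<Longrightarrow> lie_endo M Z (J 2) p v = (2 * \<epsilon> 1) *\<^sub>R J 3 p v"
    and f_sign: "(\<forall>p\<in>mpoints M. f p > 0) \<or> (\<forall>p\<in>mpoints M. f p < 0)"
    and f1_sign: "(\<forall>p\<in>mpoints M. f p - g p (Z p) (Z p) / 2 > 0) \<or>
      (\<forall>p\<in>mpoints M. f p - g p (Z p) (Z p) / 2 < 0)"
begin

abbreviation \<omega> :: "nat \<Rightarrow> 'm \<Rightarrow> 'e \<Rightarrow> 'e \<Rightarrow> real" where
  "\<omega> \<equiv> fundamental_form \<epsilon> g J"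

definition f1 :: "'m \<Rightarrow> real" where
  "f1 p = f p - g p (Z p) (Z p) / 2"

definition \<beta> :: "'m \<Rightarrow> 'e \<Rightarrow> real" where
  "\<beta> p v = g p (Z p) v"

definition Dv :: "'m \<Rightarrow> 'e set" where
  "Dv p = span {Z p, J 1 p (Z p), J 2 p (Z p), J 3 p (Z p)}"

definition Dh :: "'m \<Rightarrow> 'e set" where
  "Dh p = {y. \<forall>w\<in>Dv p. g p y w = 0}"

end

text \<open>\<open>\<xi>\<close> is the tangent vector of \<open>G\<close> at the identity that corresponds to 1 under the
  identification of the Lie algebra with the real numbers; \<open>XP\<close> is its fundamental vector field.\<close>

locale hk_bundle = hk_data e \<epsilon> M g J f Z
  for e \<epsilon> and M :: "('m, 'e::euclidean_space) mfd" and g J f Z +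
  fixes G :: "('g, real) mfd" and H :: "'g monoid" and \<xi> :: real
    and P :: "('p, 'e \<times> real) mfd"
    and \<pi> :: "'p \<Rightarrow> 'm"
    and act :: "'p \<Rightarrow> 'g \<Rightarrow> 'p"
    and \<eta> :: "'p \<Rightarrow> 'e \<times> real \<Rightarrow> real"
  assumes principal: "principal_bundle G H P M \<pi> act"
    and abelian: "comm_group H"
    and \<xi>_nonzero: "\<xi> \<noteq> 0"
    and \<eta>_smooth: "smooth_one_form P \<eta>"
    and \<eta>_invariant: "\<And>p h v. p \<in> mpoints P \<Longrightarrow> h \<in> carrier H \<Longrightarrow>
      \<eta> (act p h) (tmap P P (\<lambda>q. act q h) p v) = \<eta> p v"
    and \<eta>_normalised: "\<And>p. p \<in> mpoints P \<Longrightarrow> \<eta> p (tmap G P (act p) \<one>\<^bsub>H\<^esub> \<xi>) = 1"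
    and \<eta>_curvature: "\<And>p u v. p \<in> mpoints P \<Longrightarrow> ext_d1 P \<eta> p u v =
      fundamental_form \<epsilon> g J 1 (\<pi> p) (tmap P M \<pi> p u) (tmap P M \<pi> p v)
      - ext_d1 M (hk_data.\<beta> g Z) (\<pi> p) (tmap P M \<pi> p u) (tmap P M \<pi> p v) / 2"
begin

abbreviation d\<pi> :: "'p \<Rightarrow> 'e \<times> real \<Rightarrow> 'e" where
  "d\<pi> \<equiv> tmap P M \<pi>"

definition XP :: "'p \<Rightarrow> 'e \<times> real" where
  "XP p = tmap G P (act p) \<one>\<^bsub>H\<^esub> \<xi>"

definition hlift :: "'p \<Rightarrow> 'e \<Rightarrow> 'e \<times> real" where
  "hlift p y = (THE w. \<eta> p w = 0 \<and> d\<pi> p w = y)"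

definition Z1P :: "'p \<Rightarrow> 'e \<times> real" where
  "Z1P p = hlift p (Z (\<pi> p)) + f1 (\<pi> p) *\<^sub>R XP p"

definition gP :: "'p \<Rightarrow> 'e \<times> real \<Rightarrow> 'e \<times> real \<Rightarrow> real" where
  "gP p u v = 2 / f1 (\<pi> p) * \<eta> p u * \<eta> p v + g (\<pi> p) (d\<pi> p u) (d\<pi> p v)"

definition \<theta>0 :: "'p \<Rightarrow> 'e \<times> real \<Rightarrow> real" where
  "\<theta>0 p v = dfun P (\<lambda>q. f (\<pi> q)) p v / 2"

definition \<theta>1 :: "'p \<Rightarrow> 'e \<times> real \<Rightarrow> real" where
  "\<theta>1 p v = \<eta> p v + \<beta> (\<pi> p) (d\<pi> p v) / 2"

definition \<theta>2 :: "'p \<Rightarrow> 'e \<times> real \<Rightarrow> real" where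
  "\<theta>2 p v = - \<epsilon> 2 / 2 * \<omega> 3 (\<pi> p) (Z (\<pi> p)) (d\<pi> p v)"

definition \<theta>3 :: "'p \<Rightarrow> 'e \<times> real \<Rightarrow> real" where
  "\<theta>3 p v = \<epsilon> 2 / 2 * \<omega> 2 (\<pi> p) (Z (\<pi> p)) (d\<pi> p v)"

definition g_red :: "'p \<Rightarrow> 'e \<times> real \<Rightarrow> 'e \<times> real \<Rightarrow> real" where
  "g_red p u v = 1 / (2 * \<bar>f (\<pi> p)\<bar>) * (gP p u v - 2 / f (\<pi> p) *
     (\<theta>1 p u * \<theta>1 p v - \<epsilon> 1 * (\<theta>0 p u * \<theta>0 p v)
      - \<epsilon> 2 * (\<theta>3 p u * \<theta>3 p v) - \<epsilon> 3 * (\<theta>2 p u * \<theta>2 p v)))"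

end

text \<open>\<open>N\<close> is the submanifold \<open>M'\<close> of \<open>P\<close>, given as a subset with a manifold structure for which the
  inclusion is an immersion (the topology may be finer than the subspace topology). Its model
  space is \<open>'e\<close>, that of \<open>P\<close> is \<open>'e \<times> real\<close>, so the codimension is one.\<close>

locale hk_submanifold = hk_bundle e \<epsilon> M g J f Z G H \<xi> P \<pi> act \<eta>
  for e \<epsilon> and M :: "('m, 'e::euclidean_space) mfd" and g J f Z
    and G :: "('g, real) mfd" and H \<xi> and P :: "('p, 'e \<times> real) mfd" and \<pi> act \<eta> +
  fixes N :: "('p, 'e) mfd"
  assumes N_manifold: "smooth_manifold N"
    and N_subset: "mpoints N \<subseteq> mpoints P"
    and N_inclusion: "smooth_map_on N P (mpoints N) (\<lambda>q. q)"
    and N_immersed: "\<And>q. q \<in> mpoints N \<Longrightarrow> inj (tmap N P (\<lambda>q. q) q)"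
    and N_transversal: "\<And>q w. q \<in> mpoints N \<Longrightarrow>
      \<exists>!(v, a). w = tmap N P (\<lambda>q. q) q v + a *\<^sub>R Z1P q"
begin

abbreviation d\<iota> :: "'p \<Rightarrow> 'e \<Rightarrow> 'e \<times> real" where
  "d\<iota> \<equiv> tmap N P (\<lambda>q. q)"

definition pr :: "'p \<Rightarrow> 'e \<times> real \<Rightarrow> 'e" where
  "pr q w = (THE v. \<exists>a. w = d\<iota> q v + a *\<^sub>R Z1P q)"

definition X :: "'p \<Rightarrow> 'e" where
  "X q = pr q (XP q)"

text \<open>The value at \<open>q\<close> of the vector field \<open>Y'\<close> associated with a vector field \<open>Y\<close> on \<open>M\<close> whose value
  at \<open>\<pi> q\<close> is \<open>y\<close>.\<close>

definition prime :: "'p \<Rightarrow> 'e \<Rightarrow> 'e" where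
  "prime q y = pr q (hlift q y)"

end

text \<open>The output consists of \<open>N\<close> together with the metric \<open>g'\<close> and the bundle \<open>Q\<close> spanned by \<open>J'\<close>.\<close>

locale hk_qk_correspondence =
  hk_submanifold e \<epsilon> M g J f Z G H \<xi> P \<pi> act \<eta> N
  for e \<epsilon> and M :: "('m, 'e::euclidean_space) mfd" and g J f Z
    and G :: "('g, real) mfd" and H \<xi> and P :: "('p, 'e \<times> real) mfd" and \<pi> act \<eta>
    and N :: "('p, 'e) mfd" +
  fixes J' :: "nat \<Rightarrow> 'p \<Rightarrow> 'e \<Rightarrow> 'e"
    and g' :: "'p \<Rightarrow> 'e \<Rightarrow> 'e \<Rightarrow> real"
    and Q :: "'p \<Rightarrow> ('e \<Rightarrow> 'e) set"
  assumes J'_smooth: "\<And>\<alpha>. \<alpha> \<in> {1..3} \<Longrightarrow> smooth_endo_field_on N (mpoints N) (J' \<alpha>)"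
    and J'_square: "\<And>\<alpha> q v. \<alpha> \<in> {1..3} \<Longrightarrow> q \<in> mpoints N \<Longrightarrow> J' \<alpha> q (J' \<alpha> q v) = \<epsilon> \<alpha> *\<^sub>R v"
    and J'_product: "\<And>q v. q \<in> mpoints N \<Longrightarrow> J' 1 q (J' 2 q v) = J' 3 q v"
    and J'_X: "\<And>\<alpha> q. \<alpha> \<in> {1..3} \<Longrightarrow> q \<in> mpoints N \<Longrightarrow>
      J' \<alpha> q (X q) = (- 1 / f1 (\<pi> q)) *\<^sub>R prime q (J \<alpha> (\<pi> q) (Z (\<pi> q)))"
    and J'_vertical: "\<And>\<alpha> \<beta> \<gamma> q. (\<alpha>, \<beta>, \<gamma>) \<in> cyclic3 \<Longrightarrow> q \<in> mpoints N \<Longrightarrow>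
      J' \<alpha> q (prime q (J \<beta> (\<pi> q) (Z (\<pi> q)))) =
        (\<epsilon> 3 * \<epsilon> \<gamma>) *\<^sub>R prime q (J \<gamma> (\<pi> q) (Z (\<pi> q)))"
    and J'_horizontal: "\<And>\<alpha> q y. \<alpha> \<in> {1..3} \<Longrightarrow> q \<in> mpoints N \<Longrightarrow> y \<in> Dh (\<pi> q) \<Longrightarrow>
      J' \<alpha> q (prime q y) = prime q (J \<alpha> (\<pi> q) y)"
    and g'_eq: "\<And>q u v. q \<in> mpoints N \<Longrightarrow> g' q u v = g_red q (d\<iota> q u) (d\<iota> q v)"
    and Q_eq: "\<And>q. q \<in> mpoints N \<Longrightarrow> Q q = endo_span (\<lambda>\<alpha>. J' \<alpha> q)"

end

theory Submission
  imports Defs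
begin

text \<open>Why \<open>J'\<^sub>1\<close> is integrable. The assignment \<open>Y \<mapsto> Y'\<close>, horizontal lift to \<open>P\<close> followed by projection along
  \<open>Z\<^sub>1\<^sup>P\<close>, is at each point of \<open>M'\<close> an isomorphism from the tangent space of \<open>M\<close> to that of \<open>M'\<close>, and all the
  rules defining \<open>J'\<^sub>1\<close> say that it carries \<open>J\<^sub>1\<close> to \<open>J'\<^sub>1\<close> (\<open>J'_prime\<close>). It respects Lie brackets up to
  curvature. With \<open>F = \<omega>\<^sub>1 - d\<beta> / 2\<close>, the bracket of two horizontal lifts is the lift of the bracket minus
  \<open>F(Y, W) X\<^sub>P\<close>, and \<open>X\<^sub>P\<close> equals \<open>- Z / f\<^sub>1\<close>, lifted, modulo \<open>Z\<^sub>1\<^sup>P\<close>. Because \<open>df\<^sub>1 = - F(Z, \<cdot>)\<close>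
  (\<open>f1_rep_derivative\<close>), the bracket of \<open>Z\<^sub>1\<^sup>P\<close> with the lift of \<open>W\<close> is the lift of \<open>[Z, W]\<close>; as
  \<open>Z\<close> preserves \<open>J\<^sub>1\<close>, the contributions of \<open>Z\<^sub>1\<^sup>P\<close> to the Nijenhuis tensor cancel. Altogether

    \<open>N'(Y', W') = (N(Y, W) + (F(J\<^sub>1 Y, J\<^sub>1 W) Z - F(J\<^sub>1 Y, W) J\<^sub>1 Z - F(Y, J\<^sub>1 W) J\<^sub>1 Z + \<epsilon>\<^sub>1 F(Y, W) Z) / f\<^sub>1)'\<close>,

  where \<open>N\<close> and \<open>N'\<close> are the Nijenhuis tensors of \<open>J\<^sub>1\<close> and \<open>J'\<^sub>1\<close>.

  Now \<open>N = 0\<close> because \<open>J\<^sub>1\<close> is the recursion operator between the two closed forms \<open>\<omega>\<^sub>2\<close> and \<open>\<epsilon>\<^sub>1 \<omega>\<^sub>3\<close>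
  (\<open>J1_integrable\<close>), and the other terms cancel because \<open>F\<close> is of type \<open>(1, 1)\<close> with respect to \<open>J\<^sub>1\<close>
  (\<open>curv_J1\<close>): this is clear for \<open>\<omega>\<^sub>1\<close>, and \<open>\<beta> = - df \<circ> J\<^sub>1\<close> makes \<open>d\<beta>\<close> a \<open>d d\<^sup>c\<close> of a function for an
  integrable structure (\<open>ext_d_beta_J1\<close>).

  As tangent vectors are represented in charts that vary with the point, the computation is carried out in
  components. There the inverse of \<open>Y \<mapsto> Y'\<close> becomes the differential of \<open>M' \<rightarrow> M\<close>, corrected by the
  one-form \<open>\<eta> / f\<^sub>1\<close> times \<open>Z\<close>, and the displayed formula turns into the pointwise identity
  \<open>nijenhuis_projected_structure\<close>. That \<open>J'\<^sub>1\<close> is an almost \<open>\<epsilon>\<^sub>1\<close>-complex structure is part of the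
  construction, except for the equal ranks of the eigendistributions in the para-complex case; they
  are exchanged by \<open>J'\<^sub>2\<close>.\<close>

section \<open>Derivatives of linear families and symmetry of second derivatives\<close>

text \<open>The components of a tensor field in a chart depend smoothly on the point for each choice of constant
  arguments, and linearly on the arguments. The product rule for a varying argument follows from this by
  expanding the argument in a basis.\<close>

lemma linear_derivative_of_linear_family:
  fixes A :: "'a::real_normed_vector \<Rightarrow> 'b::euclidean_space \<Rightarrow> 'c::real_normed_vector"
  assumes S: "open S" "x \<in> S"
    and lin: "\<And>y. y \<in> S \<Longrightarrow> linear (A y)"
    and dA: "\<And>v. ((\<lambda>y. A y v) has_derivative (\<lambda>w. A' w v)) (at x)"
  shows "linear (A' w)"
proof (rule linearI)
  fix u v
  have "((\<lambda>y. A y u + A y v) has_derivative (\<lambda>w. A' w u + A' w v)) (at x)"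
    by (intro has_derivative_add dA)
  then have "((\<lambda>y. A y (u + v)) has_derivative (\<lambda>w. A' w u + A' w v)) (at x)"
    by (rule has_derivative_transform_within_open[OF _ S]) (simp add: linear_add[OF lin])
  from has_derivative_unique[OF this dA] show "A' w (u + v) = A' w u + A' w v"
    by metis
next
  fix r u
  have "((\<lambda>y. r *\<^sub>R A y u) has_derivative (\<lambda>w. r *\<^sub>R A' w u)) (at x)"
    by (intro has_derivative_scaleR_right dA)
  then have "((\<lambda>y. A y (r *\<^sub>R u)) has_derivative (\<lambda>w. r *\<^sub>R A' w u)) (at x)"
    by (rule has_derivative_transform_within_open[OF _ S]) (simp add: linear_scale[OF lin])
  from has_derivative_unique[OF this dA] show "A' w (r *\<^sub>R u) = r *\<^sub>R A' w u"
    by metis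
qed

lemma has_derivative_linear_family:
  fixes A :: "'a::real_normed_vector \<Rightarrow> 'b::euclidean_space \<Rightarrow> 'c::real_normed_vector"
  assumes S: "open S" "x \<in> S"
    and lin: "\<And>y. y \<in> S \<Longrightarrow> linear (A y)"
    and dA: "\<And>v. ((\<lambda>y. A y v) has_derivative (\<lambda>w. A' w v)) (at x)"
    and dg: "(g has_derivative g') (at x)"
  shows "((\<lambda>y. A y (g y)) has_derivative (\<lambda>w. A' w (g x) + A x (g' w))) (at x)"
proof -
  have lin': "linear (A' w)" for w
    using linear_derivative_of_linear_family[OF S lin dA] .
  have expand: "L v = (\<Sum>b\<in>Basis. (v \<bullet> b) *\<^sub>R L b)" if "linear L" for L :: "'b \<Rightarrow> 'c" and v
    by (metis (mono_tags, lifting) euclidean_representation linear_scale linear_sum sum.cong that)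
  have "((\<lambda>y. \<Sum>b\<in>Basis. (g y \<bullet> b) *\<^sub>R A y b) has_derivative
      (\<lambda>w. \<Sum>b\<in>Basis. (g x \<bullet> b) *\<^sub>R A' w b + (g' w \<bullet> b) *\<^sub>R A x b)) (at x)"
    by (intro has_derivative_sum has_derivative_scaleR dA has_derivative_inner_left dg)
  also have "(\<lambda>w. \<Sum>b\<in>Basis. (g x \<bullet> b) *\<^sub>R A' w b + (g' w \<bullet> b) *\<^sub>R A x b)
      = (\<lambda>w. A' w (g x) + A x (g' w))"
    by (rule ext) (simp add: sum.distrib expand[OF lin', where v = "g x"] expand[OF lin[OF S(2)], where v = "g' _"])
  finally show ?thesis
    by (rule has_derivative_transform_within_open[OF _ S]) (simp add: expand[OF lin, where v = "g _"])
qed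

text \<open>The mean value theorem in direction \<open>u\<close>, followed by one in direction \<open>v\<close>. The second difference
  on the left is symmetric in \<open>u\<close> and \<open>v\<close>, so carrying out the two steps in the other order expresses it
  by the other mixed derivative; letting \<open>h\<close> tend to 0 identifies the two.\<close>

lemma second_difference_mean_value:
  fixes f :: "'a::real_normed_vector \<Rightarrow> real"
  assumes h: "0 < h"
    and S: "\<And>s t. \<lbrakk>0 \<le> s; s \<le> h; 0 \<le> t; t \<le> h\<rbrakk> \<Longrightarrow> x + s *\<^sub>R u + t *\<^sub>R v \<in> S"
    and f1: "\<And>y. y \<in> S \<Longrightarrow> (f has_derivative f' y) (at y)"
    and f2: "\<And>y. y \<in> S \<Longrightarrow> ((\<lambda>y. f' y u) has_derivative f'' y) (at y)"
  obtains s t where "0 \<le> s" "s \<le> h" "0 \<le> t" "t \<le> h"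
    "f (x + h *\<^sub>R u + h *\<^sub>R v) - f (x + h *\<^sub>R u) - f (x + h *\<^sub>R v) + f x
      = h * (h * f'' (x + s *\<^sub>R u + t *\<^sub>R v) v)"
proof -
  have scale: "f' y (k *\<^sub>R w) = k * f' y w" "f'' y (k *\<^sub>R w) = k * f'' y w" if "y \<in> S" for y k w
    using f1[OF that] f2[OF that]
    by (metis bounded_linear_def has_derivative_bounded_linear linear_scale real_scaleR_def)+
  have line: "((\<lambda>k. y + k *\<^sub>R w) has_derivative (\<lambda>k. k *\<^sub>R w)) (at r)" for y w :: 'a and r
    by (auto intro!: derivative_eq_intros)
  define a where "a s = f (x + s *\<^sub>R u + h *\<^sub>R v) - f (x + s *\<^sub>R u)" for s
  have da: "(a has_derivative (\<lambda>k. k * (f' (x + s *\<^sub>R u + h *\<^sub>R v) u - f' (x + s *\<^sub>R u) u)))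
      (at s within {0..h})" if "0 \<le> s" "s \<le> h" for s
  proof -
    have *: "x + s *\<^sub>R u + h *\<^sub>R v \<in> S" "x + s *\<^sub>R u \<in> S"
      using S[of s h] S[of s 0] that h by auto
    have "((\<lambda>s. f (x + s *\<^sub>R u + h *\<^sub>R v)) has_derivative (\<lambda>k. f' (x + s *\<^sub>R u + h *\<^sub>R v) (k *\<^sub>R u))) (at s)"
      using has_derivative_compose[OF line[of "x + h *\<^sub>R v" u s], of f "f' (x + s *\<^sub>R u + h *\<^sub>R v)"]
        f1[OF *(1)] by (simp add: algebra_simps)
    moreover have "((\<lambda>s. f (x + s *\<^sub>R u)) has_derivative (\<lambda>k. f' (x + s *\<^sub>R u) (k *\<^sub>R u))) (at s)"
      using has_derivative_compose[OF line f1[OF *(2)]] .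
    ultimately have "(a has_derivative (\<lambda>k. f' (x + s *\<^sub>R u + h *\<^sub>R v) (k *\<^sub>R u) - f' (x + s *\<^sub>R u) (k *\<^sub>R u))) (at s)"
      unfolding a_def by (rule has_derivative_diff)
    then show ?thesis
      using * by (simp add: scale right_diff_distrib has_derivative_at_withinI)
  qed
  obtain s where s: "s \<in> {0..h}" "a h - a 0 = (h - 0) * (f' (x + s *\<^sub>R u + h *\<^sub>R v) u - f' (x + s *\<^sub>R u) u)"
    using mvt_very_simple[of 0 h a, OF _ da] h by auto
  have db: "((\<lambda>t. f' (x + s *\<^sub>R u + t *\<^sub>R v) u) has_derivative (\<lambda>k. k * f'' (x + s *\<^sub>R u + t *\<^sub>R v) v))
      (at t within {0..h})" if "0 \<le> t" "t \<le> h" for t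
  proof -
    have *: "x + s *\<^sub>R u + t *\<^sub>R v \<in> S" using S[of s t] that s by auto
    have "((\<lambda>t. f' (x + s *\<^sub>R u + t *\<^sub>R v) u) has_derivative (\<lambda>k. f'' (x + s *\<^sub>R u + t *\<^sub>R v) (k *\<^sub>R v))) (at t)"
      using has_derivative_compose[OF line f2[OF *]] .
    then show ?thesis using * by (simp add: scale has_derivative_at_withinI)
  qed
  obtain t where t: "t \<in> {0..h}"
    "f' (x + s *\<^sub>R u + h *\<^sub>R v) u - f' (x + s *\<^sub>R u + 0 *\<^sub>R v) u = (h - 0) * f'' (x + s *\<^sub>R u + t *\<^sub>R v) v"
    using mvt_very_simple[of 0 h "\<lambda>t. f' (x + s *\<^sub>R u + t *\<^sub>R v) u", OF _ db] h by auto
  show thesis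
    by (rule that[of s t]) (use s t in \<open>auto simp: a_def\<close>)
qed

lemma symmetric_second_derivative_real:
  fixes f :: "'a::real_normed_vector \<Rightarrow> real"
  assumes S: "open S" "x \<in> S"
    and f1: "\<And>y. y \<in> S \<Longrightarrow> (f has_derivative f' y) (at y)"
    and f2: "\<And>y v. y \<in> S \<Longrightarrow> ((\<lambda>y. f' y v) has_derivative f'' y v) (at y)"
    and cont: "\<And>u v. continuous_on S (\<lambda>y. f'' y u v)"
  shows "f'' x u v = f'' x v u"
proof (rule ccontr)
  assume neq: "f'' x u v \<noteq> f'' x v u"
  define e where "e = \<bar>f'' x u v - f'' x v u\<bar> / 2"
  have e: "e > 0" using neq by (simp add: e_def)
  have lim: "((\<lambda>y. f'' y u v) \<longlongrightarrow> f'' x u v) (nhds x)" for u v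
    using cont S by (metis continuous_on_eq_continuous_at continuous_at tendsto_at_iff_tendsto_nhds)
  have "\<forall>\<^sub>F y in nhds x. y \<in> S \<and> dist (f'' y u v) (f'' x u v) < e \<and> dist (f'' y v u) (f'' x v u) < e"
    using S e by (intro eventually_conj tendstoD[OF lim] eventually_nhds_in_open)
  then obtain d where d: "d > 0" and near: "\<And>y. dist y x < d \<Longrightarrow>
      y \<in> S \<and> dist (f'' y u v) (f'' x u v) < e \<and> dist (f'' y v u) (f'' x v u) < e"
    unfolding eventually_nhds_metric by blast
  define h where "h = d / (2 * (norm u + norm v + 1))"
  have pos: "norm u + norm v + 1 > 0" by (simp add: add_nonneg_pos)
  have h: "h > 0" unfolding h_def using d pos by simp
  have "h * (norm u + norm v) \<le> h * (norm u + norm v + 1)" using h by simp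
  also have "\<dots> = d / 2" unfolding h_def using pos by (simp add: field_simps)
  finally have hd: "h * (norm u + norm v) < d" using d by simp
  have close: "dist (x + s *\<^sub>R u + t *\<^sub>R v) x < d" if "0 \<le> s" "s \<le> h" "0 \<le> t" "t \<le> h" for s t
  proof -
    have "dist (x + s *\<^sub>R u + t *\<^sub>R v) x \<le> s * norm u + t * norm v"
      using that norm_triangle_ineq[of "s *\<^sub>R u" "t *\<^sub>R v"] by (simp add: dist_norm add.assoc)
    also have "\<dots> \<le> h * norm u + h * norm v"
      by (intro add_mono mult_right_mono that) auto
    finally show ?thesis using hd by (simp add: distrib_left)
  qed
  have close': "dist (x + s *\<^sub>R v + t *\<^sub>R u) x < d" if "0 \<le> s" "s \<le> h" "0 \<le> t" "t \<le> h" for s t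
    using close[OF that(3,4,1,2)] by (metis add.assoc add.commute)
  obtain s t where st: "0 \<le> s" "s \<le> h" "0 \<le> t" "t \<le> h"
    "f (x + h *\<^sub>R u + h *\<^sub>R v) - f (x + h *\<^sub>R u) - f (x + h *\<^sub>R v) + f x
      = h * (h * f'' (x + s *\<^sub>R u + t *\<^sub>R v) u v)"
    by (rule second_difference_mean_value[of h x u v S f f' "\<lambda>y. f'' y u"])
       (use h near close f1 f2 in auto)
  obtain s' t' where st': "0 \<le> s'" "s' \<le> h" "0 \<le> t'" "t' \<le> h"
    "f (x + h *\<^sub>R v + h *\<^sub>R u) - f (x + h *\<^sub>R v) - f (x + h *\<^sub>R u) + f x
      = h * (h * f'' (x + s' *\<^sub>R v + t' *\<^sub>R u) v u)"
    by (rule second_difference_mean_value[of h x v u S f f' "\<lambda>y. f'' y v"])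
       (use h near close' f1 f2 in auto)
  have "h * (h * f'' (x + s *\<^sub>R u + t *\<^sub>R v) u v) = h * (h * f'' (x + s' *\<^sub>R v + t' *\<^sub>R u) v u)"
    using st(5) st'(5) by (smt (verit) add.assoc add.commute)
  moreover have "x + s' *\<^sub>R v + t' *\<^sub>R u = x + t' *\<^sub>R u + s' *\<^sub>R v"
    by simp
  ultimately have eq: "f'' (x + s *\<^sub>R u + t *\<^sub>R v) u v = f'' (x + t' *\<^sub>R u + s' *\<^sub>R v) v u"
    using h by simp
  have "\<bar>f'' (x + s *\<^sub>R u + t *\<^sub>R v) u v - f'' x u v\<bar> < e"
    using near[OF close[OF st(1-4)]] by (simp add: dist_real_def)
  moreover have "\<bar>f'' (x + t' *\<^sub>R u + s' *\<^sub>R v) v u - f'' x v u\<bar> < e"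
    using near[OF close[OF st'(3,4,1,2)]] by (simp add: dist_real_def)
  moreover have "\<bar>a - b\<bar> \<le> \<bar>c - a\<bar> + \<bar>c - b\<bar>" for a b c :: real
    by linarith
  ultimately show False unfolding eq e_def by (smt (verit) field_sum_of_halves)
qed

lemma smooth_on_imp_differentiable: "smooth_on S f \<Longrightarrow> x \<in> S \<Longrightarrow> f differentiable (at x)"
  unfolding smooth_on_def by (metis Ck_on.simps(2))

lemma smooth_on_has_derivative:
  "smooth_on S f \<Longrightarrow> x \<in> S \<Longrightarrow> (f has_derivative frechet_derivative f (at x)) (at x)"
  using smooth_on_imp_differentiable frechet_derivative_works by blast

lemma smooth_on_linear_derivative: "smooth_on S f \<Longrightarrow> x \<in> S \<Longrightarrow> linear (frechet_derivative f (at x))"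
  using smooth_on_imp_differentiable linear_frechet_derivative by blast

lemma smooth_on_frechet_derivative:
  "smooth_on S f \<Longrightarrow> smooth_on S (\<lambda>x. frechet_derivative f (at x) v)"
  unfolding smooth_on_def by (metis Ck_on.simps(2))

lemma smooth_on_continuous: "smooth_on S f \<Longrightarrow> continuous_on S f"
  unfolding smooth_on_def by (metis Ck_on.simps(1))

lemma symmetric_second_derivative:
  fixes f :: "'a::euclidean_space \<Rightarrow> 'b::euclidean_space"
  assumes f: "smooth_on S f" and S: "open S" "x \<in> S"
  shows "frechet_derivative (\<lambda>y. frechet_derivative f (at y) u) (at x) v =
    frechet_derivative (\<lambda>y. frechet_derivative f (at y) v) (at x) u"
proof (rule euclidean_eqI)
  fix b :: 'b
  let ?f'' = "\<lambda>y u v. frechet_derivative (\<lambda>y. frechet_derivative f (at y) u) (at y) v"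
  show "?f'' x u v \<bullet> b = ?f'' x v u \<bullet> b"
  proof (rule symmetric_second_derivative_real[where f = "\<lambda>y. f y \<bullet> b"
        and f' = "\<lambda>y v. frechet_derivative f (at y) v \<bullet> b" and f'' = "\<lambda>y u v. ?f'' y u v \<bullet> b", OF S])
    fix y assume y: "y \<in> S"
    show "((\<lambda>y. f y \<bullet> b) has_derivative (\<lambda>v. frechet_derivative f (at y) v \<bullet> b)) (at y)"
      by (intro has_derivative_inner_left smooth_on_has_derivative[OF f y])
    show "((\<lambda>y. frechet_derivative f (at y) w \<bullet> b) has_derivative (\<lambda>v. ?f'' y w v \<bullet> b)) (at y)" for w
      by (intro has_derivative_inner_left smooth_on_has_derivative[OF smooth_on_frechet_derivative[OF f] y])
  next
    show "continuous_on S (\<lambda>y. ?f'' y u v \<bullet> b)" for u v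
      by (intro continuous_intros smooth_on_continuous smooth_on_frechet_derivative f)
  qed
qed

section \<open>Charts\<close>

abbreviation fderiv :: "('a::real_normed_vector \<Rightarrow> 'b::real_normed_vector) \<Rightarrow> 'a \<Rightarrow> 'a \<Rightarrow> 'b" where
  "fderiv F x \<equiv> frechet_derivative F (at x)"

lemma fderiv_transform_within_open:
  assumes "(F has_derivative F') (at x)" "open S" "x \<in> S" "\<And>y. y \<in> S \<Longrightarrow> F y = G y"
  shows "fderiv G x = F'"
  using has_derivative_transform_within_open[OF assms] frechet_derivative_at by metis

lemma has_derivative_fderiv:
  "(F has_derivative F') (at x) \<Longrightarrow> (F has_derivative fderiv F x) (at x)"
  using frechet_derivative_works differentiable_def by blast

lemma chart_openin: "smooth_manifold M \<Longrightarrow> c \<in> atlas M \<Longrightarrow> openin (mtop M) (fst c)"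
  unfolding smooth_manifold_def by blast

lemma chart_subset: "smooth_manifold M \<Longrightarrow> c \<in> atlas M \<Longrightarrow> fst c \<subseteq> mpoints M"
  using chart_openin openin_subset by blast

lemma chart_homeomorphic:
  "smooth_manifold M \<Longrightarrow> c \<in> atlas M \<Longrightarrow>
    homeomorphic_map (subtopology (mtop M) (fst c)) (top_of_set (snd c ` fst c)) (snd c)"
  unfolding smooth_manifold_def by blast

lemma chart_inj_on:
  assumes "smooth_manifold M" "c \<in> atlas M"
  shows "inj_on (snd c) (fst c)"
  using homeomorphic_imp_injective_map[OF chart_homeomorphic[OF assms]] chart_subset[OF assms]
  by (simp add: Int_absorb1)

lemma cinv_chart [simp]:
  "smooth_manifold M \<Longrightarrow> c \<in> atlas M \<Longrightarrow> p \<in> fst c \<Longrightarrow> cinv c (snd c p) = p"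
  using chart_inj_on inv_into_f_f by metis

lemma open_chart_image:
  assumes "smooth_manifold M" "c \<in> atlas M" "openin (mtop M) V" "V \<subseteq> fst c"
  shows "open (snd c ` V)"
proof -
  have "open (snd c ` fst c)" using assms(1,2) unfolding smooth_manifold_def by blast
  moreover have "openin (subtopology (mtop M) (fst c)) V"
    using assms by (simp add: openin_open_subtopology chart_openin)
  ultimately show ?thesis
    using homeomorphic_imp_open_map[OF chart_homeomorphic[OF assms(1,2)]]
    unfolding open_map_def by (metis openin_open_eq)
qed

lemma open_chart_range: "smooth_manifold M \<Longrightarrow> c \<in> atlas M \<Longrightarrow> open (snd c ` fst c)"
  by (rule open_chart_image) (auto simp: chart_openin)

lemma chart_at_mem:
  assumes "smooth_manifold M" "p \<in> mpoints M"
  shows "chart_at M p \<in> atlas M" "p \<in> fst (chart_at M p)"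
proof -
  have "\<exists>c. c \<in> atlas M \<and> p \<in> fst c" using assms unfolding smooth_manifold_def by blast
  then have "chart_at M p \<in> atlas M \<and> p \<in> fst (chart_at M p)"
    unfolding chart_at_def by (rule someI_ex)
  then show "chart_at M p \<in> atlas M" "p \<in> fst (chart_at M p)" by auto
qed

lemma openin_preimage:
  assumes "smooth_map_on M N U F" "openin (mtop N) W"
  shows "openin (mtop M) {p \<in> U. F p \<in> W}"
proof -
  have U: "openin (mtop M) U" and F: "continuous_map (subtopology (mtop M) U) (mtop N) F"
    using assms(1) unfolding smooth_map_on_def by auto
  have "openin (subtopology (mtop M) U) {p \<in> topspace (subtopology (mtop M) U). F p \<in> W}"
    by (rule openin_continuous_map_preimage[OF F assms(2)])
  moreover have "topspace (subtopology (mtop M) U) = U"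
    using openin_subset[OF U] by auto
  ultimately have "openin (subtopology (mtop M) U) {p \<in> U. F p \<in> W}"
    by (simp only:)
  then show ?thesis using openin_open_subtopology[OF U] by blast
qed

lemma transition_has_derivative:
  assumes M: "smooth_manifold M" and c: "c \<in> atlas M" "p \<in> fst c" and d: "d \<in> atlas M" "p \<in> fst d"
  shows "((snd d \<circ> cinv c) has_derivative tchange c d p) (at (snd c p))"
  unfolding tchange_def
  by (rule smooth_on_has_derivative[of "snd c ` (fst c \<inter> fst d)"])
     (use assms in \<open>auto simp: smooth_manifold_def\<close>)

lemma linear_tchange:
  assumes "smooth_manifold M" "c \<in> atlas M" "p \<in> fst c" "d \<in> atlas M" "p \<in> fst d"
  shows "linear (tchange c d p)"
  using transition_has_derivative[OF assms] has_derivative_linear by blast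

lemma tchange_compose:
  assumes M: "smooth_manifold M" and c: "c \<in> atlas M" "p \<in> fst c" and d: "d \<in> atlas M" "p \<in> fst d"
    and e: "e \<in> atlas M" "p \<in> fst e"
  shows "tchange d e p (tchange c d p v) = tchange c e p v"
proof -
  let ?S = "snd c ` (fst c \<inter> fst d)"
  have d': "((snd e \<circ> cinv d) has_derivative tchange d e p) (at ((snd d \<circ> cinv c) (snd c p)))"
    using transition_has_derivative[OF M d e] M c by simp
  have "fderiv (snd e \<circ> cinv c) (snd c p) = tchange d e p \<circ> tchange c d p"
  proof (rule fderiv_transform_within_open[OF diff_chain_at[OF transition_has_derivative[OF M c d] d']])
    show "open ?S" by (rule open_chart_image[OF M c(1)]) (use M c d in \<open>auto simp: chart_openin\<close>)
    show "((snd e \<circ> cinv d) \<circ> (snd d \<circ> cinv c)) y = (snd e \<circ> cinv c) y" if "y \<in> ?S" for y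
      using that M c d by auto
  qed (use c d in auto)
  then show ?thesis unfolding tchange_def[of c e] by simp
qed

lemma tchange_refl:
  assumes M: "smooth_manifold M" and c: "c \<in> atlas M" "p \<in> fst c"
  shows "tchange c c p v = v"
proof -
  have "fderiv (snd c \<circ> cinv c) (snd c p) = (\<lambda>x. x)"
    by (rule fderiv_transform_within_open[OF has_derivative_ident open_chart_range[OF M c(1)]])
       (use M c in auto)
  then show ?thesis unfolding tchange_def by simp
qed

lemma to_chart_of_chart [simp]:
  assumes M: "smooth_manifold M" and c: "c \<in> atlas M" "p \<in> fst c"
  shows "to_chart M c p (of_chart M c p v) = v" "of_chart M c p (to_chart M c p v) = v"
proof -
  have p: "p \<in> mpoints M" using c chart_subset[OF M c(1)] by auto
  note d = chart_at_mem[OF M p]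
  show "to_chart M c p (of_chart M c p v) = v" "of_chart M c p (to_chart M c p v) = v"
    unfolding to_chart_def of_chart_def
    using tchange_compose[OF M c d c] tchange_compose[OF M d c d] tchange_refl[OF M c] tchange_refl[OF M d]
    by auto
qed

lemma linear_to_chart:
  assumes M: "smooth_manifold M" and c: "c \<in> atlas M" "p \<in> fst c"
  shows "linear (to_chart M c p)" "linear (of_chart M c p)"
proof -
  have p: "p \<in> mpoints M" using c chart_subset[OF M c(1)] by auto
  note d = chart_at_mem[OF M p]
  show "linear (to_chart M c p)" "linear (of_chart M c p)"
    unfolding to_chart_def of_chart_def by (intro linear_tchange[OF M] c d)+
qed

lemma to_chart_at [simp]:
  assumes M: "smooth_manifold M" and p: "p \<in> mpoints M"
  shows "to_chart M (chart_at M p) p v = v" "of_chart M (chart_at M p) p v = v"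
  unfolding to_chart_def of_chart_def using tchange_refl[OF M chart_at_mem[OF M p]] by auto

text \<open>By definition, \<open>tmap\<close> at \<open>p\<close> refers to the charts chosen at \<open>p\<close> and \<open>F p\<close>, and the choice
  depends on \<open>p\<close> in an uncontrolled way. To differentiate a differential once more it has to be written
  in one pair of charts on a whole neighbourhood, at the price of the two coordinate changes. The same
  applies to \<open>dfun\<close>.\<close>

lemma tmap_in_charts:
  assumes M: "smooth_manifold M" and N: "smooth_manifold N" and F: "smooth_map_on M N U F"
    and p: "p \<in> U" and c: "c \<in> atlas M" "p \<in> fst c" and d: "d \<in> atlas N" "F p \<in> fst d"
  shows "((snd d \<circ> F \<circ> cinv c) has_derivative
    (\<lambda>v. to_chart N d (F p) (tmap M N F p (of_chart M c p v)))) (at (snd c p))"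
proof -
  have pM: "p \<in> mpoints M" using c chart_subset[OF M c(1)] by auto
  have FN: "F p \<in> mpoints N" using d chart_subset[OF N d(1)] by auto
  define c' where "c' = chart_at M p"
  define d' where "d' = chart_at N (F p)"
  note c' = chart_at_mem[OF M pM, folded c'_def] and d' = chart_at_mem[OF N FN, folded d'_def]
  let ?G = "snd d' \<circ> F \<circ> cinv c'"
  have G: "(?G has_derivative tmap M N F p) (at (snd c' p))"
    unfolding tmap_def c'_def[symmetric] d'_def[symmetric]
    by (rule smooth_on_has_derivative[of "snd c' ` {p \<in> U \<inter> fst c'. F p \<in> fst d'}"])
       (use F c' d' p in \<open>auto simp: smooth_map_on_def\<close>)
  have 1: "((snd c' \<circ> cinv c) has_derivative of_chart M c p) (at (snd c p))"
    unfolding of_chart_def c'_def[symmetric] by (rule transition_has_derivative[OF M c c'])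
  have 2: "((?G \<circ> (snd c' \<circ> cinv c)) has_derivative (tmap M N F p \<circ> of_chart M c p)) (at (snd c p))"
    by (rule diff_chain_at[OF 1]) (use M c G in simp)
  have 3: "((snd d \<circ> cinv d') has_derivative to_chart N d (F p)) (at (snd d' (F p)))"
    unfolding to_chart_def d'_def[symmetric] by (rule transition_has_derivative[OF N d' d])
  have 4: "((snd d \<circ> cinv d') \<circ> (?G \<circ> (snd c' \<circ> cinv c)) has_derivative
     (to_chart N d (F p) \<circ> (tmap M N F p \<circ> of_chart M c p))) (at (snd c p))"
    by (rule diff_chain_at[OF 2]) (use M c c' 3 in simp)
  define V where "V = fst c \<inter> fst c' \<inter> {p \<in> U. F p \<in> fst d'}"
  have "openin (mtop M) V" unfolding V_def
    by (intro openin_Int openin_preimage[OF F] chart_openin M N c c' d')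
  then have "open (snd c ` V)" by (rule open_chart_image[OF M c(1)]) (auto simp: V_def)
  moreover have "((snd d \<circ> cinv d') \<circ> (?G \<circ> (snd c' \<circ> cinv c))) y = (snd d \<circ> F \<circ> cinv c) y"
    if "y \<in> snd c ` V" for y
    using that M N c c' d' by (auto simp: V_def)
  moreover have "snd c p \<in> snd c ` V" using c c' d' p by (auto simp: V_def)
  ultimately show ?thesis using has_derivative_transform_within_open[OF 4] by (simp add: o_def)
qed

lemma smooth_map_on_in_charts:
  assumes "smooth_map_on M N U F" "c \<in> atlas M" "d \<in> atlas N"
  shows "smooth_on (snd c ` {p \<in> U \<inter> fst c. F p \<in> fst d}) (snd d \<circ> F \<circ> cinv c)"
  using assms unfolding smooth_map_on_def by blast

lemma linear_tmap:
  assumes M: "smooth_manifold M" and N: "smooth_manifold N" and F: "smooth_map_on M N U F"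
    and p: "p \<in> U" and FN: "F p \<in> mpoints N"
  shows "linear (tmap M N F p)"
proof -
  have pM: "p \<in> mpoints M" using F p openin_subset unfolding smooth_map_on_def by blast
  from has_derivative_linear[OF tmap_in_charts[OF M N F p chart_at_mem[OF M pM] chart_at_mem[OF N FN]]]
  show ?thesis using M N pM FN by simp
qed

lemma dfun_in_chart:
  assumes M: "smooth_manifold M" and h: "smooth_fun M h" and c: "c \<in> atlas M" "p \<in> fst c"
  shows "fderiv (h \<circ> cinv c) (snd c p) v = dfun M h p (of_chart M c p v)"
proof -
  have pM: "p \<in> mpoints M" using c chart_subset[OF M c(1)] by auto
  define c' where "c' = chart_at M p"
  note c' = chart_at_mem[OF M pM, folded c'_def]
  have h': "((h \<circ> cinv c') has_derivative dfun M h p) (at (snd c' p))"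
    unfolding dfun_def c'_def[symmetric]
    by (rule smooth_on_has_derivative[of "snd c' ` fst c'"])
       (use h c' in \<open>auto simp: smooth_fun_def\<close>)
  have 1: "((snd c' \<circ> cinv c) has_derivative of_chart M c p) (at (snd c p))"
    unfolding of_chart_def c'_def[symmetric] by (rule transition_has_derivative[OF M c c'])
  have 2: "((h \<circ> cinv c') \<circ> (snd c' \<circ> cinv c) has_derivative (dfun M h p \<circ> of_chart M c p)) (at (snd c p))"
    by (rule diff_chain_at[OF 1]) (use M c h' in simp)
  have "open (snd c ` (fst c \<inter> fst c'))"
    by (rule open_chart_image[OF M c(1)]) (use M c c' in \<open>auto simp: chart_openin\<close>)
  then have "fderiv (h \<circ> cinv c) (snd c p) = dfun M h p \<circ> of_chart M c p"
    by (rule fderiv_transform_within_open[OF 2]) (use M c c' in auto)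
  then show ?thesis by simp
qed

section \<open>Components of tensor fields\<close>

text \<open>Every differential operator on fields is evaluated below on components with respect to the chart
  chosen at the point of interest, where the coordinate changes reduce to the identity. Extensions of
  tangent vectors have constant components there, so their Lie brackets vanish and each invariant
  formula collapses to its terms with derivatives of components.\<close>

definition vec_rep :: "('a, 'e::euclidean_space) mfd \<Rightarrow> ('a, 'e) chart \<Rightarrow> ('a \<Rightarrow> 'e) \<Rightarrow> 'e \<Rightarrow> 'e" where
  "vec_rep M c X x = to_chart M c (cinv c x) (X (cinv c x))"

definition endo_rep ::
  "('a, 'e::euclidean_space) mfd \<Rightarrow> ('a, 'e) chart \<Rightarrow> ('a \<Rightarrow> 'e \<Rightarrow> 'e) \<Rightarrow> 'e \<Rightarrow> 'e \<Rightarrow> 'e" where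
  "endo_rep M c A x v = to_chart M c (cinv c x) (A (cinv c x) (of_chart M c (cinv c x) v))"

definition form_rep ::
  "('a, 'e::euclidean_space) mfd \<Rightarrow> ('a, 'e) chart \<Rightarrow> ('a \<Rightarrow> 'e \<Rightarrow> real) \<Rightarrow> 'e \<Rightarrow> 'e \<Rightarrow> real" where
  "form_rep M c \<alpha> x v = \<alpha> (cinv c x) (of_chart M c (cinv c x) v)"

definition bil_rep ::
  "('a, 'e::euclidean_space) mfd \<Rightarrow> ('a, 'e) chart \<Rightarrow> ('a \<Rightarrow> 'e \<Rightarrow> 'e \<Rightarrow> real) \<Rightarrow> 'e \<Rightarrow> 'e \<Rightarrow> 'e \<Rightarrow> real" where
  "bil_rep M c B x u v = B (cinv c x) (of_chart M c (cinv c x) u) (of_chart M c (cinv c x) v)"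

lemma rep_at:
  assumes "smooth_manifold M" "p \<in> mpoints M"
  shows "vec_rep M (chart_at M p) X (snd (chart_at M p) p) = X p"
    and "endo_rep M (chart_at M p) A (snd (chart_at M p) p) v = A p v"
    and "form_rep M (chart_at M p) \<alpha> (snd (chart_at M p) p) v = \<alpha> p v"
    and "bil_rep M (chart_at M p) B (snd (chart_at M p) p) u v = B p u v"
  using assms chart_at_mem[OF assms]
  unfolding vec_rep_def endo_rep_def form_rep_def bil_rep_def by auto

lemma smooth_vec_rep: "smooth_vector_field M X \<Longrightarrow> c \<in> atlas M \<Longrightarrow> smooth_on (snd c ` fst c) (vec_rep M c X)"
  unfolding smooth_vector_field_def vec_rep_def by blast

lemma smooth_form_rep:
  "smooth_one_form M \<alpha> \<Longrightarrow> c \<in> atlas M \<Longrightarrow> smooth_on (snd c ` fst c) (\<lambda>x. form_rep M c \<alpha> x v)"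
  unfolding smooth_one_form_def form_rep_def by blast

lemma smooth_bil_rep:
  "pseudo_riemannian M B \<Longrightarrow> c \<in> atlas M \<Longrightarrow> smooth_on (snd c ` fst c) (\<lambda>x. bil_rep M c B x u v)"
  unfolding pseudo_riemannian_def bil_rep_def by blast

lemma smooth_endo_rep:
  assumes "smooth_manifold M" "smooth_endo_field_on M (mpoints M) A" "c \<in> atlas M"
  shows "smooth_on (snd c ` fst c) (\<lambda>x. endo_rep M c A x v)"
  using assms(2,3) chart_subset[OF assms(1,3)]
  unfolding smooth_endo_field_on_def endo_rep_def by (auto simp: Int_absorb1)

lemma linear_endo_rep:
  assumes M: "smooth_manifold M" and c: "c \<in> atlas M" "x \<in> snd c ` fst c" and "linear (A (cinv c x))"
  shows "linear (endo_rep M c A x)"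
proof -
  have "cinv c x \<in> fst c" using M c by auto
  from linear_compose[OF linear_compose[OF linear_to_chart(2)[OF M c(1) this] assms(4)] linear_to_chart(1)[OF M c(1) this]]
  show ?thesis unfolding endo_rep_def[abs_def] by (simp add: o_def)
qed

lemma linear_form_rep:
  assumes M: "smooth_manifold M" and c: "c \<in> atlas M" "x \<in> snd c ` fst c" and "linear (\<alpha> (cinv c x))"
  shows "linear (form_rep M c \<alpha> x)"
proof -
  have "cinv c x \<in> fst c" using M c by auto
  from linear_compose[OF linear_to_chart(2)[OF M c(1) this] assms(4)]
  show ?thesis unfolding form_rep_def[abs_def] by (simp add: o_def)
qed

lemma bilinear_bil_rep:
  assumes M: "smooth_manifold M" and c: "c \<in> atlas M" "x \<in> snd c ` fst c" and B: "bilinear (B (cinv c x))"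
  shows "bilinear (bil_rep M c B x)"
proof -
  have "cinv c x \<in> fst c" using M c by auto
  note L = linear_to_chart(2)[OF M c(1) this]
  show ?thesis unfolding bilinear_def bil_rep_def
    using linear_compose[OF L, of "B (cinv c x) w" for w]
      linear_compose[OF L, of "\<lambda>u. B (cinv c x) u w" for w] B
    unfolding bilinear_def o_def by blast
qed

lemma vec_rep_local_ext:
  assumes M: "smooth_manifold M" and p: "p \<in> mpoints M"
  shows "fderiv (vec_rep M (chart_at M p) (local_ext M p v)) (snd (chart_at M p) p) = (\<lambda>w. 0)"
    and "local_ext M p v p = v"
proof -
  note c = chart_at_mem[OF M p]
  show "fderiv (vec_rep M (chart_at M p) (local_ext M p v)) (snd (chart_at M p) p) = (\<lambda>w. 0)"
    by (rule fderiv_transform_within_open[OF has_derivative_const[of v] open_chart_range[OF M c(1)]])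
       (use M c in \<open>auto simp: vec_rep_def local_ext_def\<close>)
  show "local_ext M p v p = v" unfolding local_ext_def using M p by simp
qed

lemma lie_bracket_in_chart:
  assumes M: "smooth_manifold M" and p: "p \<in> mpoints M" and c: "c = chart_at M p"
  shows "lie_bracket M X Y p =
    fderiv (vec_rep M c Y) (snd c p) (X p) - fderiv (vec_rep M c X) (snd c p) (Y p)"
  using rep_at(1)[OF M p] unfolding lie_bracket_def Let_def c vec_rep_def[abs_def] by metis

lemma nijenhuis_in_chart:
  assumes M: "smooth_manifold M" and p: "p \<in> mpoints M" and c: "c = chart_at M p"
    and A: "linear (A p)"
  shows "nijenhuis M A p u v =
      fderiv (\<lambda>x. endo_rep M c A x v) (snd c p) (A p u) - fderiv (\<lambda>x. endo_rep M c A x u) (snd c p) (A p v)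
      + A p (fderiv (\<lambda>x. endo_rep M c A x u) (snd c p) v)
      - A p (fderiv (\<lambda>x. endo_rep M c A x v) (snd c p) u)"
proof -
  have *: "vec_rep M c (\<lambda>q. A q (local_ext M p w q)) = (\<lambda>x. endo_rep M c A x w)" for w
    unfolding vec_rep_def endo_rep_def local_ext_def c by auto
  show ?thesis
    unfolding nijenhuis_def Let_def lie_bracket_in_chart[OF M p c] *
    using vec_rep_local_ext[OF M p] A by (simp add: c linear_0 linear_diff linear_neg)
qed

lemma ext_d1_in_chart:
  assumes M: "smooth_manifold M" and p: "p \<in> mpoints M" and c: "c = chart_at M p"
    and \<alpha>: "linear (\<alpha> p)"
  shows "ext_d1 M \<alpha> p u v =
    fderiv (\<lambda>x. form_rep M c \<alpha> x v) (snd c p) u - fderiv (\<lambda>x. form_rep M c \<alpha> x u) (snd c p) v"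
proof -
  have "lie_bracket M (local_ext M p u) (local_ext M p v) p = 0"
    unfolding lie_bracket_in_chart[OF M p c] using vec_rep_local_ext[OF M p] by (simp add: c)
  then show ?thesis
    using \<alpha> unfolding ext_d1_def Let_def dfun_def c[symmetric] form_rep_def local_ext_def o_def
    by (simp add: linear_0)
qed

lemma ext_d2_in_chart:
  assumes M: "smooth_manifold M" and p: "p \<in> mpoints M" and c: "c = chart_at M p"
    and B: "bilinear (B p)"
  shows "ext_d2 M B p u v w =
    fderiv (\<lambda>x. bil_rep M c B x v w) (snd c p) u - fderiv (\<lambda>x. bil_rep M c B x u w) (snd c p) v
    + fderiv (\<lambda>x. bil_rep M c B x u v) (snd c p) w"
proof -
  have "lie_bracket M (local_ext M p u) (local_ext M p v) p = 0" for u v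
    unfolding lie_bracket_in_chart[OF M p c] using vec_rep_local_ext[OF M p] by (simp add: c)
  then show ?thesis
    using B unfolding ext_d2_def Let_def dfun_def c[symmetric] bil_rep_def local_ext_def o_def
    by (simp add: bilinear_lzero)
qed

lemma lie_bilinear_form_in_chart:
  assumes M: "smooth_manifold M" and p: "p \<in> mpoints M" and c: "c = chart_at M p"
    and B: "bilinear (B p)"
  shows "lie_bilinear_form M Z B p u v = fderiv (\<lambda>x. bil_rep M c B x u v) (snd c p) (Z p)
    + B p (fderiv (vec_rep M c Z) (snd c p) u) v + B p u (fderiv (vec_rep M c Z) (snd c p) v)"
proof -
  have *: "lie_bracket M Z (local_ext M p u) p = - fderiv (vec_rep M c Z) (snd c p) u" for u
    unfolding lie_bracket_in_chart[OF M p c] using vec_rep_local_ext[OF M p] by (simp add: c)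
  show ?thesis
    using B unfolding lie_bilinear_form_def Let_def dfun_def c[symmetric] * bil_rep_def
    by (simp add: bilinear_lneg bilinear_rneg local_ext_def o_def c[symmetric] vec_rep_local_ext[OF M p]
      to_chart_at[OF M p, folded c])
qed

lemma lie_endo_in_chart:
  assumes M: "smooth_manifold M" and p: "p \<in> mpoints M" and c: "c = chart_at M p"
    and A: "linear (A p)"
  shows "lie_endo M Z A p v = fderiv (\<lambda>x. endo_rep M c A x v) (snd c p) (Z p)
    - fderiv (vec_rep M c Z) (snd c p) (A p v) + A p (fderiv (vec_rep M c Z) (snd c p) v)"
proof -
  have *: "vec_rep M c (\<lambda>q. A q (local_ext M p w q)) = (\<lambda>x. endo_rep M c A x w)" for w
    unfolding vec_rep_def endo_rep_def local_ext_def c by auto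
  show ?thesis
    unfolding lie_endo_def Let_def lie_bracket_in_chart[OF M p c] *
    using vec_rep_local_ext[OF M p] A by (simp add: c linear_neg)
qed

section \<open>Pointwise identities for Nijenhuis tensors\<close>

text \<open>A pointwise form of the statement that a recursion operator between two closed two-forms has
  vanishing Nijenhuis tensor. Here \<open>D\<omega> w\<close>, \<open>D\<sigma> w\<close> and \<open>DJ w\<close> are the derivatives, in direction \<open>w\<close>, of the
  components of \<open>\<omega>\<close>, of \<open>\<sigma> = \<omega>(J \<cdot>, \<cdot>)\<close> and of \<open>J\<close>. Also \<open>\<sigma>(J \<cdot>, \<cdot>) = \<epsilon> \<omega>\<close> is closed, and for the
  Nijenhuis tensor \<open>N\<close> of \<open>J\<close> the number \<open>\<omega>(N(u, v), z)\<close> is a combination of \<open>d\<omega>(J u, J v, z)\<close>, \<open>d\<sigma>(J u, v, z)\<close>,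
  \<open>d\<sigma>(u, J v, z)\<close> and \<open>\<epsilon> d\<omega>(u, v, z)\<close>.\<close>

lemma bi_hamiltonian_nijenhuis:
  fixes J :: "'e::euclidean_space \<Rightarrow> 'e" and \<omega> :: "'e \<Rightarrow> 'e \<Rightarrow> real" and D\<omega> D\<sigma> :: "'e \<Rightarrow> 'e \<Rightarrow> 'e \<Rightarrow> real"
  assumes \<omega>: "bilinear \<omega>" and nondeg: "\<And>u. (\<And>v. \<omega> u v = 0) \<Longrightarrow> u = 0"
    and sym: "\<And>u v. \<omega> (J u) v = \<omega> u (J v)"
    and D\<omega>_skew: "\<And>w u v. D\<omega> w u v = - D\<omega> w v u"
    and D\<sigma>_skew: "\<And>w u v. D\<sigma> w u v = - D\<sigma> w v u"
    and D\<sigma>1: "\<And>w u v. D\<sigma> w u v = D\<omega> w (J u) v + \<omega> (DJ w u) v"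
    and J2: "\<And>w v. DJ w (J v) + J (DJ w v) = 0" "\<And>v. J (J v) = \<epsilon> *\<^sub>R v"
    and D\<omega>_scale: "\<And>w r u v. D\<omega> w (r *\<^sub>R u) v = r * D\<omega> w u v"
    and closed: "\<And>u v w. D\<omega> u v w - D\<omega> v u w + D\<omega> w u v = 0"
      "\<And>u v w. D\<sigma> u v w - D\<sigma> v u w + D\<sigma> w u v = 0"
  shows "DJ (J u) v - DJ (J v) u + J (DJ v u) - J (DJ u v) = 0"
proof (rule nondeg)
  fix z
  (* The derivative of \<sigma>(J \<cdot>, \<cdot>) = \<epsilon> \<omega>, rewritten without derivatives of J. *)
  have eps: "\<epsilon> * D\<omega> w u v = D\<sigma> w (J u) v + D\<sigma> w u (J v) - D\<omega> w (J u) (J v)" for w u v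
  proof -
    have "DJ w (J u) = - J (DJ w u)" using J2(1) by (simp add: eq_neg_iff_add_eq_0)
    then have "\<omega> (DJ w (J u)) v = - \<omega> (DJ w u) (J v)"
      using \<omega> sym by (simp add: bilinear_lneg)
    then show ?thesis
      using D\<sigma>1[of w "J u" v] D\<sigma>1[of w u "J v"] by (simp add: J2(2) D\<omega>_scale)
  qed
  have DJ: "\<omega> (DJ w u) v = D\<sigma> w u v - D\<omega> w (J u) v" for w u v
    using D\<sigma>1[of w u v] by simp
  have "\<omega> (DJ (J u) v - DJ (J v) u + J (DJ v u) - J (DJ u v)) z =
     \<omega> (DJ (J u) v) z - \<omega> (DJ (J v) u) z + \<omega> (DJ v u) (J z) - \<omega> (DJ u v) (J z)"
    using \<omega> sym by (simp add: bilinear_ladd bilinear_lsub)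
  also have "\<dots> = 0"
    unfolding DJ
    using closed(1)[of "J u" "J v" z] closed(2)[of "J u" v z] closed(2)[of "J v" u z]
      eps[of v u z] eps[of u v z] eps[of z u v] closed(1)[of u v z]
      D\<omega>_skew D\<sigma>_skew
    by (smt (verit) distrib_left right_diff_distrib mult_zero_right)
  finally show "\<omega> (DJ (J u) v - DJ (J v) u + J (DJ v u) - J (DJ u v)) z = 0" .
qed

text \<open>The computation behind the theorem. At one point, \<open>T\<close> is an isomorphism from tangent vectors of one
  manifold to tangent vectors of another that intertwines \<open>K\<close> with \<open>J\<close>, but it is not the differential
  \<open>\<phi>\<close> of a map: it differs from it by a one-form \<open>a\<close> times a vector field \<open>Z\<close>. Differentiating
  \<open>T K = J T\<close> gives

    \<open>T N\<^sub>K(u, v) = N\<^sub>J(T u, T v) - dT(K u, K v) + J dT(K u, v) + J dT(u, K v) - \<epsilon> dT(u, v)\<close>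

  up to terms \<open>a \<otimes> \<partial>\<^sub>Z J\<close>. Since \<open>Z\<close> preserves \<open>J\<close>, those terms cancel the derivatives of \<open>Z\<close> that occur
  in \<open>dT\<close>. What is left of \<open>dT\<close> is a multiple of \<open>F(T u, T v) Z\<close>, and these contributions
  cancel because \<open>F\<close> is of type \<open>(1, 1)\<close>.\<close>

lemma nijenhuis_projected_structure:
  fixes J K T :: "'e::euclidean_space \<Rightarrow> 'e" and DT DJ DK :: "'e \<Rightarrow> 'e \<Rightarrow> 'e"
    and F :: "'e \<Rightarrow> 'e \<Rightarrow> real" and a :: "'e \<Rightarrow> real"
  assumes lin: "linear J" "linear T" "\<And>v. linear (\<lambda>w. DJ w v)" "linear DZ"
    and inj: "inj T"
    and J2: "\<And>v. J (J v) = \<epsilon> *\<^sub>R v"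
    and TK: "\<And>v. T (K v) = J (T v)"
    and DTK: "\<And>w v. DT w (K v) + T (DK w v) = DJ (\<phi> w) (T v) + J (DT w v)"
    and \<phi>: "\<And>w. \<phi> w = T w + a w *\<^sub>R Z"
    and dT: "\<And>u v. DT u v - DT v u = - (k * F (T u) (T v)) *\<^sub>R Z - a v *\<^sub>R DZ (T u) + a u *\<^sub>R DZ (T v)"
    and lieJ: "\<And>v. DJ Z v = DZ (J v) - J (DZ v)"
    and NJ: "\<And>u v. DJ (J u) v - DJ (J v) u + J (DJ v u) - J (DJ u v) = 0"
    and F11: "\<And>u v. F (J u) v = - F u (J v)" and F_scale: "\<And>r u v. F u (r *\<^sub>R v) = r * F u v"
  shows "DK (K u) v - DK (K v) u + K (DK v u) - K (DK u v) = 0"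
proof -
  define N where "N = DK (K u) v - DK (K v) u + K (DK v u) - K (DK u v)"
  have TDK: "T (DK w v) = DJ (T w) (T v) + a w *\<^sub>R (DZ (J (T v)) - J (DZ (T v))) + J (DT w v) - DT w (K v)"
    for w v
  proof -
    have "DJ (\<phi> w) (T v) = DJ (T w) (T v) + a w *\<^sub>R DJ Z (T v)"
      unfolding \<phi> linear_add[OF lin(3)] linear_scale[OF lin(3)] ..
    moreover have "T (DK w v) = DJ (\<phi> w) (T v) + J (DT w v) - DT w (K v)"
      using DTK[of w v] by (simp add: eq_diff_eq add.commute)
    ultimately show ?thesis by (simp add: lieJ)
  qed
  have dT': "DT u v = DT v u - (k * F (T u) (T v)) *\<^sub>R Z - a v *\<^sub>R DZ (T u) + a u *\<^sub>R DZ (T v)" for u v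
    using dT[of u v] by (simp add: algebra_simps)
  have FJJ: "F (J (T u)) (J (T v)) = - \<epsilon> * F (T u) (T v)"
    using F11 F_scale J2 by simp
  have NT: "DJ (J (T u)) (T v) = DJ (J (T v)) (T u) - J (DJ (T v) (T u)) + J (DJ (T u) (T v))"
    using NJ[of "T u" "T v"] by (simp add: algebra_simps)
  have JJ: "J (DZ (J (J x))) = \<epsilon> *\<^sub>R J (DZ x)" "DZ (J (J x)) = \<epsilon> *\<^sub>R DZ x" for x
    using J2 lin by (simp_all add: linear_scale)
  have "T N = T (DK (K u) v) - T (DK (K v) u) + J (T (DK v u)) - J (T (DK u v))"
    unfolding N_def using lin(2) TK by (simp add: linear_add linear_diff)
  also have "\<dots> = 0"
    unfolding TDK TK NT
    using lin(1)
    by (simp add: dT'[of "K u" "K v"] dT'[of "K u" v] dT'[of u "K v"] dT'[of u v] TK linear_add linear_diff linear_scale linear_neg J2 JJ FJJ F11 F_scale scaleR_diff_right scaleR_add_right algebra_simps)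
  finally have "T N = T 0" using lin(2) by (simp add: linear_0)
  then show ?thesis using inj unfolding N_def by (simp add: inj_eq)
qed

section \<open>The hyper-Kaehler manifold with its Killing field\<close>

(* Keeps the index 1 of the quaternionic triples from being rewritten to Suc 0. *)
declare One_nat_def [simp del]

text \<open>Only \<open>J1 J2 = J3\<close> is postulated; that \<open>J1\<close> and \<open>J2\<close> anticommute is forced by the squares
  and by \<open>\<epsilon>\<^sub>3 = - \<epsilon>\<^sub>1 \<epsilon>\<^sub>2\<close>.\<close>

lemma quaternionic_anticommute:
  fixes J1 J2 J3 :: "'e::real_vector \<Rightarrow> 'e"
  assumes lin: "linear J1" "linear J2"
    and sq: "\<And>v. J1 (J1 v) = e1 *\<^sub>R v" "\<And>v. J2 (J2 v) = e2 *\<^sub>R v" "\<And>v. J3 (J3 v) = e3 *\<^sub>R v"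
    and prod: "\<And>v. J1 (J2 v) = J3 v"
    and e: "e3 = - e1 * e2" "e1 * e2 \<noteq> 0"
  shows "J2 (J1 v) = - J3 v"
proof -
  have "J1 (J2 (J1 (J2 (J2 v)))) = e3 *\<^sub>R J2 v" using sq(3)[of "J2 v"] prod by simp
  then have "J1 (J1 (J2 (J1 (J2 (J2 v))))) = e3 *\<^sub>R J3 v"
    using lin prod by (simp add: linear_scale)
  then have "(e1 * e2) *\<^sub>R J2 (J1 v) = (e1 * e2) *\<^sub>R (- J3 v)"
    using lin by (simp add: sq linear_scale e mult.commute)
  then show ?thesis by (rule scaleR_left_imp_eq[OF e(2)])
qed

lemma alpha_cases: "(\<alpha>::nat) \<in> {1..3} \<longleftrightarrow> \<alpha> = 1 \<or> \<alpha> = 2 \<or> \<alpha> = 3"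
  by auto

context hk_data
begin

lemma M_manifold: "smooth_manifold M"
  and g_metric: "pseudo_riemannian M g"
  using hyper_kaehler unfolding eps_hyper_kaehler_def by auto

lemma eps_sq: "\<epsilon> 1 * \<epsilon> 1 = 1" "\<epsilon> 2 * \<epsilon> 2 = 1" "\<epsilon> 3 * \<epsilon> 3 = 1"
  and eps3: "\<epsilon> 3 = - \<epsilon> 1 * \<epsilon> 2"
  and eps_nz: "\<epsilon> 1 \<noteq> 0" "\<epsilon> 2 \<noteq> 0" "\<epsilon> 3 \<noteq> 0"
  using eps unfolding eps_triple_def by auto

lemma J_smooth: "\<alpha> \<in> {1..3} \<Longrightarrow> smooth_endo_field_on M (mpoints M) (J \<alpha>)"
  using hyper_kaehler unfolding eps_hyper_kaehler_def by blast

lemma omega_closed: "\<alpha> \<in> {1..3} \<Longrightarrow> p \<in> mpoints M \<Longrightarrow> ext_d2 M (\<omega> \<alpha>) p u v w = 0"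
  using hyper_kaehler unfolding eps_hyper_kaehler_def by blast

context
  fixes p assumes p: "p \<in> mpoints M"
begin

lemma frame: "quaternionic_frame \<epsilon> (g p) (\<lambda>\<alpha>. J \<alpha> p)"
  using hyper_kaehler p unfolding eps_hyper_kaehler_def by blast

lemma J_linear: "\<alpha> \<in> {1..3} \<Longrightarrow> linear (J \<alpha> p)"
  and J_square: "\<alpha> \<in> {1..3} \<Longrightarrow> J \<alpha> p (J \<alpha> p v) = \<epsilon> \<alpha> *\<^sub>R v"
  and J_skew: "\<alpha> \<in> {1..3} \<Longrightarrow> g p (J \<alpha> p v) w = - g p v (J \<alpha> p w)"
  and J_product: "J 1 p (J 2 p v) = J 3 p v"
  using frame unfolding quaternionic_frame_def by blast+

lemma J_anticommute: "J 2 p (J 1 p v) = - J 3 p v"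
  by (rule quaternionic_anticommute[of "J 1 p" "J 2 p" "\<epsilon> 1" "\<epsilon> 2" "J 3 p" "\<epsilon> 3"])
     (use J_linear J_square J_product eps3 eps_nz in auto)

lemma g_bilinear: "bilinear (g p)"
  and g_sym: "g p u v = g p v u"
  and g_nondegenerate: "(\<And>v. g p u v = 0) \<Longrightarrow> u = 0"
  using g_metric p unfolding pseudo_riemannian_def by blast+

lemmas g_simps = bilinear_ladd[OF g_bilinear] bilinear_radd[OF g_bilinear]
  bilinear_lmul[OF g_bilinear] bilinear_rmul[OF g_bilinear]
  bilinear_lneg[OF g_bilinear] bilinear_rneg[OF g_bilinear]
  bilinear_lsub[OF g_bilinear] bilinear_rsub[OF g_bilinear]

lemma omega_bilinear: "\<alpha> \<in> {1..3} \<Longrightarrow> bilinear (\<omega> \<alpha> p)"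
  using J_linear unfolding bilinear_def fundamental_form_def
  by (auto intro!: linearI simp: linear_add linear_scale g_simps algebra_simps)

lemma omega_skew: "\<alpha> \<in> {1..3} \<Longrightarrow> \<omega> \<alpha> p u v = - \<omega> \<alpha> p v u"
  unfolding fundamental_form_def using J_skew[of \<alpha> u v] g_sym[of u "J \<alpha> p v"] by simp

text \<open>Up to sign, \<open>J\<^sub>1\<close> is the recursion operator between the closed forms \<open>\<omega>\<^sub>2\<close> and \<open>\<omega>\<^sub>3\<close>.\<close>

lemma omega2_J1: "\<omega> 2 p (J 1 p u) v = \<epsilon> 1 * \<omega> 3 p u v" "\<omega> 2 p u (J 1 p v) = \<epsilon> 1 * \<omega> 3 p u v"
proof -
  have *: "\<epsilon> 2 = - \<epsilon> 1 * \<epsilon> 3" using eps3 eps_sq by simp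
  show "\<omega> 2 p (J 1 p u) v = \<epsilon> 1 * \<omega> 3 p u v"
    unfolding fundamental_form_def J_anticommute * by (simp add: g_simps)
  have "g p (J 2 p u) (J 1 p v) = - g p (J 3 p u) v"
    using J_skew[of 1 "J 2 p u" v] J_product by simp
  then show "\<omega> 2 p u (J 1 p v) = \<epsilon> 1 * \<omega> 3 p u v"
    unfolding fundamental_form_def * by simp
qed

text \<open>\<open>\<beta>\<close> is, up to sign, \<open>d\<^sup>c f\<close>: apply \<open>\<omega>\<^sub>1(Z, \<cdot>) = - df\<close> to \<open>J\<^sub>1 v\<close>.\<close>

lemma beta_J1: "\<beta> p v = - dfun M f p (J 1 p v)"
proof -
  have "dfun M f p (J 1 p v) = \<epsilon> 1 * g p (J 1 p (Z p)) (J 1 p v)"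
    using Z_hamiltonian[OF p, of "J 1 p v"] by (simp add: fundamental_form_def)
  also have "\<dots> = - (\<epsilon> 1 * \<epsilon> 1) * g p (Z p) v"
    using J_skew[of 1 "Z p" "J 1 p v"] J_square[of 1 v] by (simp add: g_simps)
  finally show ?thesis by (simp add: \<beta>_def eps_sq)
qed

lemma beta_linear: "linear (\<beta> p)"
  using g_bilinear unfolding \<beta>_def[abs_def] bilinear_def by blast

end

abbreviation Df :: "'m \<Rightarrow> 'e \<Rightarrow> real" where
  "Df \<equiv> dfun M f"

text \<open>The form on \<open>M\<close> whose pull-back is the curvature of the connection \<open>\<eta>\<close>.\<close>

definition curv :: "'m \<Rightarrow> 'e \<Rightarrow> 'e \<Rightarrow> real" where
  "curv p u v = \<omega> 1 p u v - ext_d1 M \<beta> p u v / 2"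

text \<open>All derivatives at \<open>p\<close> are taken in the chart chosen at \<open>p\<close>.\<close>

context
  fixes p c x
  assumes p: "p \<in> mpoints M" and c: "c = chart_at M p" and x: "x = snd c p"
begin

private abbreviation (input) S where "S \<equiv> snd c ` fst c"

lemma c_atlas: "c \<in> atlas M" "p \<in> fst c"
  using chart_at_mem[OF M_manifold p] c by auto

lemma S_open: "open S" "x \<in> S"
  using open_chart_range[OF M_manifold c_atlas(1)] c_atlas x by auto

lemma cinv_S: "y \<in> S \<Longrightarrow> cinv c y \<in> fst c" "y \<in> S \<Longrightarrow> cinv c y \<in> mpoints M"
  using cinv_chart[OF M_manifold c_atlas(1)] chart_subset[OF M_manifold c_atlas(1)] by auto

lemmas at_x = rep_at[OF M_manifold p, folded c, folded x]

lemma cinv_x: "cinv c x = p" "of_chart M c p v = v"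
  using cinv_chart[OF M_manifold c_atlas] to_chart_at[OF M_manifold p] x c by auto

lemma J_rep_linear: "\<alpha> \<in> {1..3} \<Longrightarrow> y \<in> S \<Longrightarrow> linear (endo_rep M c (J \<alpha>) y)"
  by (intro linear_endo_rep M_manifold c_atlas J_linear cinv_S)

lemma J_rep_derivative: "\<alpha> \<in> {1..3} \<Longrightarrow> ((\<lambda>y. endo_rep M c (J \<alpha>) y v) has_derivative
    fderiv (\<lambda>y. endo_rep M c (J \<alpha>) y v) x) (at x)"
  by (rule smooth_on_has_derivative[OF smooth_endo_rep[OF M_manifold J_smooth c_atlas(1)] S_open(2)])

lemma g_rep_bilinear: "y \<in> S \<Longrightarrow> bilinear (bil_rep M c g y)"
  by (intro bilinear_bil_rep M_manifold c_atlas g_bilinear cinv_S)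

lemma g_rep_derivative: "((\<lambda>y. bil_rep M c g y u v) has_derivative fderiv (\<lambda>y. bil_rep M c g y u v) x) (at x)"
  by (rule smooth_on_has_derivative[OF smooth_bil_rep[OF g_metric c_atlas(1)] S_open(2)])

lemma Z_rep_derivative: "(vec_rep M c Z has_derivative fderiv (vec_rep M c Z) x) (at x)"
  by (rule smooth_on_has_derivative[OF smooth_vec_rep[OF Z_smooth c_atlas(1)] S_open(2)])

lemma omega_rep: "y \<in> S \<Longrightarrow> bil_rep M c (\<omega> \<alpha>) y u v = - \<epsilon> \<alpha> * bil_rep M c g y (endo_rep M c (J \<alpha>) y u) v"
  unfolding bil_rep_def endo_rep_def fundamental_form_def
  using to_chart_of_chart[OF M_manifold c_atlas(1) cinv_S(1)] by simp

lemma omega_rep_bilinear: "\<alpha> \<in> {1..3} \<Longrightarrow> y \<in> S \<Longrightarrow> bilinear (bil_rep M c (\<omega> \<alpha>) y)"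
  by (intro bilinear_bil_rep M_manifold c_atlas omega_bilinear cinv_S)

lemma omega_rep_derivative:
  assumes \<alpha>: "\<alpha> \<in> {1..3}"
  shows "((\<lambda>y. bil_rep M c (\<omega> \<alpha>) y u v) has_derivative fderiv (\<lambda>y. bil_rep M c (\<omega> \<alpha>) y u v) x) (at x)"
proof -
  have "linear (\<lambda>u. bil_rep M c g y u v)" if "y \<in> S" for y
    using g_rep_bilinear[OF that] unfolding bilinear_def by blast
  from has_derivative_linear_family[OF S_open this g_rep_derivative J_rep_derivative[OF \<alpha>]]
  have "((\<lambda>y. - \<epsilon> \<alpha> * bil_rep M c g y (endo_rep M c (J \<alpha>) y u) v) has_derivative
     (\<lambda>w. - \<epsilon> \<alpha> * (fderiv (\<lambda>y. bil_rep M c g y (endo_rep M c (J \<alpha>) x u) v) x w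
       + bil_rep M c g x (fderiv (\<lambda>y. endo_rep M c (J \<alpha>) y u) x w) v))) (at x)"
    by (rule has_derivative_mult_right)
  then have "((\<lambda>y. bil_rep M c (\<omega> \<alpha>) y u v) has_derivative
     (\<lambda>w. - \<epsilon> \<alpha> * (fderiv (\<lambda>y. bil_rep M c g y (endo_rep M c (J \<alpha>) x u) v) x w
       + bil_rep M c g x (fderiv (\<lambda>y. endo_rep M c (J \<alpha>) y u) x w) v))) (at x)"
    by (rule has_derivative_transform_within_open[OF _ S_open]) (simp add: omega_rep)
  then show ?thesis by (rule has_derivative_fderiv)
qed

abbreviation (input) DJ1 :: "'e \<Rightarrow> 'e \<Rightarrow> 'e" where
  "DJ1 w v \<equiv> fderiv (\<lambda>y. endo_rep M c (J 1) y v) x w"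

lemma DJ1_J1: "DJ1 w (J 1 p v) + J 1 p (DJ1 w v) = 0"
proof -
  have 1: "((\<lambda>y. endo_rep M c (J 1) y (endo_rep M c (J 1) y v)) has_derivative
     (\<lambda>w. DJ1 w (endo_rep M c (J 1) x v) + endo_rep M c (J 1) x (DJ1 w v))) (at x)"
    by (rule has_derivative_linear_family[OF S_open J_rep_linear J_rep_derivative J_rep_derivative]) auto
  have sq: "endo_rep M c (J 1) y (endo_rep M c (J 1) y v) = \<epsilon> 1 *\<^sub>R v" if "y \<in> S" for y
    unfolding endo_rep_def
    using to_chart_of_chart[OF M_manifold c_atlas(1) cinv_S(1)[OF that]]
      linear_to_chart[OF M_manifold c_atlas(1) cinv_S(1)[OF that]]
      J_square[OF cinv_S(2)[OF that], of 1]
    by (simp add: linear_scale)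
  have "((\<lambda>y. \<epsilon> 1 *\<^sub>R v) has_derivative
     (\<lambda>w. DJ1 w (endo_rep M c (J 1) x v) + endo_rep M c (J 1) x (DJ1 w v))) (at x)"
    by (rule has_derivative_transform_within_open[OF 1 S_open sq])
  from has_derivative_unique[OF this has_derivative_const] show ?thesis
    unfolding at_x by metis
qed

lemma lie_J1_in_chart: "DJ1 (Z p) v = fderiv (vec_rep M c Z) x (J 1 p v) - J 1 p (fderiv (vec_rep M c Z) x v)"
  using lie_J1[OF p, of v] lie_endo_in_chart[OF M_manifold p c, of "J 1" Z v, OF J_linear[OF p]] x
  by (simp add: algebra_simps)

text \<open>Hitchin's lemma: closedness of the fundamental forms implies integrability. The left-hand side is the
  Nijenhuis tensor of \<open>J\<^sub>1\<close>, and \<open>\<epsilon>\<^sub>1 \<omega>\<^sub>3 = \<omega>\<^sub>2(J\<^sub>1 \<cdot>, \<cdot>)\<close>.\<close>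

lemma J1_integrable: "DJ1 (J 1 p u) v - DJ1 (J 1 p v) u + J 1 p (DJ1 v u) - J 1 p (DJ1 u v) = 0"
proof -
  define D\<omega> where "D\<omega> w u v = fderiv (\<lambda>y. bil_rep M c (\<omega> 2) y u v) x w" for w u v
  define D\<sigma> where "D\<sigma> w u v = \<epsilon> 1 * fderiv (\<lambda>y. bil_rep M c (\<omega> 3) y u v) x w" for w u v
  have skew: "fderiv (\<lambda>y. bil_rep M c (\<omega> \<alpha>) y u v) x w = - fderiv (\<lambda>y. bil_rep M c (\<omega> \<alpha>) y v u) x w"
    if \<alpha>: "\<alpha> \<in> {1..3}" for \<alpha> u v w
  proof -
    have "fderiv (\<lambda>y. bil_rep M c (\<omega> \<alpha>) y u v) x = (\<lambda>w. - fderiv (\<lambda>y. bil_rep M c (\<omega> \<alpha>) y v u) x w)"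
      by (rule fderiv_transform_within_open[OF has_derivative_minus[OF omega_rep_derivative[OF \<alpha>]] S_open])
         (simp add: bil_rep_def omega_skew[OF cinv_S(2) \<alpha>, symmetric])
    then show ?thesis by metis
  qed
  show ?thesis
  proof (rule bi_hamiltonian_nijenhuis[of "\<omega> 2 p" "J 1 p" D\<omega> D\<sigma> "\<lambda>w v. DJ1 w v" "\<epsilon> 1"])
    show "bilinear (\<omega> 2 p)" using omega_bilinear[OF p] by simp
    show "u = 0" if "\<And>v. \<omega> 2 p u v = 0" for u
    proof -
      have "J 2 p u = 0"
        using that g_nondegenerate[OF p, of "J 2 p u"] eps_nz unfolding fundamental_form_def by simp
      then have "\<epsilon> 2 *\<^sub>R u = 0" using J_square[OF p, of 2 u] J_linear[OF p, of 2] by (simp add: linear_0)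
      then show "u = 0" using eps_nz by simp
    qed
    show "\<omega> 2 p (J 1 p u) v = \<omega> 2 p u (J 1 p v)" for u v
      using omega2_J1[OF p] by simp
    show "D\<omega> w u v = - D\<omega> w v u" "D\<sigma> w u v = - D\<sigma> w v u" for w u v
      unfolding D\<omega>_def D\<sigma>_def using skew[of 2 u v w] skew[of 3 u v w] by simp_all
    have lin: "linear (\<lambda>u. bil_rep M c (\<omega> 2) y u v)" if "y \<in> S" for y v
      using omega_rep_bilinear[OF _ that, of 2] unfolding bilinear_def by simp
    have d2: "((\<lambda>y. bil_rep M c (\<omega> 2) y u v) has_derivative (\<lambda>w. D\<omega> w u v)) (at x)" for u v
      unfolding D\<omega>_def using omega_rep_derivative[of 2] by simp
    show "D\<omega> w (r *\<^sub>R u) v = r * D\<omega> w u v" for w r u v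
      using linear_scale[OF linear_derivative_of_linear_family[OF S_open lin d2]] by simp
    show "D\<sigma> w u v = D\<omega> w (J 1 p u) v + \<omega> 2 p (DJ1 w u) v" for w u v
    proof -
      have 1: "((\<lambda>y. bil_rep M c (\<omega> 2) y (endo_rep M c (J 1) y u) v) has_derivative
         (\<lambda>w. D\<omega> w (endo_rep M c (J 1) x u) v + bil_rep M c (\<omega> 2) x (DJ1 w u) v)) (at x)"
        by (rule has_derivative_linear_family[OF S_open lin d2 J_rep_derivative]) auto
      have "((\<lambda>y. \<epsilon> 1 * bil_rep M c (\<omega> 3) y u v) has_derivative
         (\<lambda>w. D\<omega> w (endo_rep M c (J 1) x u) v + bil_rep M c (\<omega> 2) x (DJ1 w u) v)) (at x)"
      proof (rule has_derivative_transform_within_open[OF 1 S_open])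
        fix y assume y: "y \<in> S"
        show "bil_rep M c (\<omega> 2) y (endo_rep M c (J 1) y u) v = \<epsilon> 1 * bil_rep M c (\<omega> 3) y u v"
          unfolding bil_rep_def endo_rep_def
          using to_chart_of_chart[OF M_manifold c_atlas(1) cinv_S(1)[OF y]] omega2_J1[OF cinv_S(2)[OF y]]
          by simp
      qed
      moreover have "((\<lambda>y. \<epsilon> 1 * bil_rep M c (\<omega> 3) y u v) has_derivative (\<lambda>w. D\<sigma> w u v)) (at x)"
        unfolding D\<sigma>_def by (intro has_derivative_mult_right omega_rep_derivative) simp
      ultimately show ?thesis
        using has_derivative_unique[of "\<lambda>y. \<epsilon> 1 * bil_rep M c (\<omega> 3) y u v" _ x "\<lambda>w. D\<sigma> w u v"] unfolding at_x
        by (simp add: fun_eq_iff)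
    qed
    show "DJ1 w (J 1 p v) + J 1 p (DJ1 w v) = 0" for w v by (rule DJ1_J1)
    show "J 1 p (J 1 p v) = \<epsilon> 1 *\<^sub>R v" for v using J_square[OF p, of 1] by simp
    show "D\<omega> u v w - D\<omega> v u w + D\<omega> w u v = 0" for u v w
      using omega_closed[of 2 p u v w] p ext_d2_in_chart[OF M_manifold p c, of "\<omega> 2" u v w, OF omega_bilinear[OF p, of 2]]
      unfolding D\<omega>_def x by simp
    have "fderiv (\<lambda>y. bil_rep M c (\<omega> 3) y v w) x u - fderiv (\<lambda>y. bil_rep M c (\<omega> 3) y u w) x v
        + fderiv (\<lambda>y. bil_rep M c (\<omega> 3) y u v) x w = 0" for u v w
      using omega_closed[of 3 p u v w] p ext_d2_in_chart[OF M_manifold p c, of "\<omega> 3" u v w, OF omega_bilinear[OF p, of 3]]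
      unfolding x by simp
    then show "D\<sigma> u v w - D\<sigma> v u w + D\<sigma> w u v = 0" for u v w
      unfolding D\<sigma>_def by (metis distrib_left mult_zero_right right_diff_distrib)
  qed
qed

lemma f_rep_smooth: "smooth_on S (f \<circ> cinv c)"
  using f_smooth c_atlas unfolding smooth_fun_def by blast

lemma f_rep_derivative:
  assumes "y \<in> S"
  shows "fderiv (f \<circ> cinv c) y v = Df (cinv c y) (of_chart M c (cinv c y) v)"
proof -
  have "snd c (cinv c y) = y" using assms by (simp add: f_inv_into_f)
  then show ?thesis
    using dfun_in_chart[OF M_manifold f_smooth c_atlas(1) cinv_S(1)[OF assms], of v] by simp
qed

lemma Df_linear: "linear (Df p)"
  using smooth_on_linear_derivative[OF f_rep_smooth S_open(2)] f_rep_derivative[OF S_open(2)]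
  unfolding linear_iff by (simp add: cinv_x)

lemma form_beta_linear: "y \<in> S \<Longrightarrow> linear (form_rep M c \<beta> y)"
  by (intro linear_form_rep M_manifold c_atlas beta_linear cinv_S)

lemma beta_rep: "y \<in> S \<Longrightarrow> form_rep M c \<beta> y v = bil_rep M c g y (vec_rep M c Z y) v"
  unfolding form_rep_def bil_rep_def vec_rep_def \<beta>_def
  using to_chart_of_chart[OF M_manifold c_atlas(1) cinv_S(1)] by simp

lemma beta_rep_derivative: "((\<lambda>y. form_rep M c \<beta> y v) has_derivative
    (\<lambda>w. fderiv (\<lambda>y. bil_rep M c g y (Z p) v) x w + g p (fderiv (vec_rep M c Z) x w) v)) (at x)"
proof -
  have "linear (\<lambda>u. bil_rep M c g y u v)" if "y \<in> S" for y
    using g_rep_bilinear[OF that] unfolding bilinear_def by blast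
  from has_derivative_linear_family[OF S_open this g_rep_derivative Z_rep_derivative]
  have 1: "((\<lambda>y. bil_rep M c g y (vec_rep M c Z y) v) has_derivative
     (\<lambda>w. fderiv (\<lambda>y. bil_rep M c g y (Z p) v) x w + g p (fderiv (vec_rep M c Z) x w) v)) (at x)"
    unfolding at_x .
  show ?thesis
    by (rule has_derivative_transform_within_open[OF 1 S_open]) (simp add: beta_rep)
qed

abbreviation (input) D\<beta> :: "'e \<Rightarrow> 'e \<Rightarrow> real" where
  "D\<beta> w v \<equiv> fderiv (\<lambda>y. form_rep M c \<beta> y v) x w"

lemma D\<beta>: "((\<lambda>y. form_rep M c \<beta> y v) has_derivative (\<lambda>w. D\<beta> w v)) (at x)"
  using beta_rep_derivative by (rule has_derivative_fderiv)

lemma D\<beta>_linear: "linear (\<lambda>w. D\<beta> w v)" "linear (\<lambda>v. D\<beta> w v)"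
  using has_derivative_linear[OF D\<beta>] linear_derivative_of_linear_family[OF S_open form_beta_linear D\<beta>]
  by simp_all

lemma ext_d_beta: "ext_d1 M \<beta> p u v = D\<beta> u v - D\<beta> v u"
  using ext_d1_in_chart[OF M_manifold p c, of \<beta> u v, OF beta_linear[OF p]] x by simp

text \<open>Because \<open>\<beta> = - df \<circ> J\<^sub>1\<close>, its differential is a \<open>d d\<^sup>c\<close>, which is of type \<open>(1, 1)\<close> for an
  integrable structure: the second derivatives of \<open>f\<close> cancel by symmetry, and the derivatives
  of \<open>J\<^sub>1\<close> add up to \<open>df\<close> of the Nijenhuis tensor.\<close>

lemma ext_d_beta_J1: "ext_d1 M \<beta> p (J 1 p u) v = - ext_d1 M \<beta> p u (J 1 p v)"
proof -
  define Hf where "Hf w v = fderiv (\<lambda>y. fderiv (f \<circ> cinv c) y v) x w" for w v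
  have Hf_sym: "Hf w v = Hf v w" for w v
    unfolding Hf_def by (rule symmetric_second_derivative[OF f_rep_smooth S_open])
  have Hf: "((\<lambda>y. fderiv (f \<circ> cinv c) y v) has_derivative (\<lambda>w. Hf w v)) (at x)" for v
    unfolding Hf_def by (rule smooth_on_has_derivative[OF smooth_on_frechet_derivative[OF f_rep_smooth] S_open(2)])
  have Hf_scale: "Hf w (r *\<^sub>R v) = r * Hf w v" for w r v
    using linear_scale[OF linear_derivative_of_linear_family[OF S_open smooth_on_linear_derivative[OF f_rep_smooth] Hf]]
    by simp
  have Dfx: "fderiv (f \<circ> cinv c) x = Df p"
    by (rule ext) (simp add: f_rep_derivative[OF S_open(2)] cinv_x)
  have D: "D\<beta> w v = - Hf w (J 1 p v) - Df p (DJ1 w v)" for w v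
  proof -
    have "((\<lambda>y. - fderiv (f \<circ> cinv c) y (endo_rep M c (J 1) y v)) has_derivative
      (\<lambda>w. - (Hf w (endo_rep M c (J 1) x v) + fderiv (f \<circ> cinv c) x (DJ1 w v)))) (at x)"
      by (intro has_derivative_minus has_derivative_linear_family[OF S_open _ Hf J_rep_derivative]
          smooth_on_linear_derivative[OF f_rep_smooth]) auto
    then have "((\<lambda>y. form_rep M c \<beta> y v) has_derivative
      (\<lambda>w. - (Hf w (endo_rep M c (J 1) x v) + fderiv (f \<circ> cinv c) x (DJ1 w v)))) (at x)"
    proof (rule has_derivative_transform_within_open[OF _ S_open])
      fix y assume y: "y \<in> S"
      show "- fderiv (f \<circ> cinv c) y (endo_rep M c (J 1) y v) = form_rep M c \<beta> y v"
        unfolding f_rep_derivative[OF y] endo_rep_def form_rep_def beta_J1[OF cinv_S(2)[OF y]]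
        using to_chart_of_chart[OF M_manifold c_atlas(1) cinv_S(1)[OF y]] by simp
    qed
    from has_derivative_unique[OF D\<beta> this] show ?thesis
      unfolding at_x Dfx by (simp add: fun_eq_iff)
  qed
  have DJJ: "DJ1 w (J 1 p v) = - J 1 p (DJ1 w v)" for w v
    using DJ1_J1 by (simp add: eq_neg_iff_add_eq_0)
  have "Df p (DJ1 (J 1 p u) v - DJ1 (J 1 p v) u + J 1 p (DJ1 v u) - J 1 p (DJ1 u v)) = 0"
    unfolding J1_integrable using Df_linear by (simp add: linear_0)
  then have N: "Df p (DJ1 (J 1 p u) v) - Df p (DJ1 (J 1 p v) u) + Df p (J 1 p (DJ1 v u))
      - Df p (J 1 p (DJ1 u v)) = 0"
    using Df_linear by (simp add: linear_add linear_diff)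
  have JJ: "J 1 p (J 1 p v) = \<epsilon> 1 *\<^sub>R v" for v using J_square[OF p, of 1] by simp
  show ?thesis
    unfolding ext_d_beta D DJJ JJ Hf_scale
    using N Hf_sym[of u v] Hf_sym[of "J 1 p u" "J 1 p v"] Df_linear
    by (simp add: linear_neg)
qed

lemma curv_J1: "curv p (J 1 p u) v = - curv p u (J 1 p v)"
  unfolding curv_def ext_d_beta_J1 fundamental_form_def
  using J_skew[OF p, of 1 "J 1 p u" v] by simp

lemma curv_linear: "linear (curv p u)" "linear (\<lambda>u. curv p u v)"
proof -
  have "bilinear (\<omega> 1 p)" using omega_bilinear[OF p, of 1] by simp
  then show "linear (curv p u)" "linear (\<lambda>u. curv p u v)"
    unfolding curv_def[abs_def] ext_d_beta bilinear_def
    using D\<beta>_linear by (auto simp: linear_iff algebra_simps add_divide_distrib diff_divide_distrib)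
qed

text \<open>\<open>df\<^sub>1 = - F(Z, \<cdot>)\<close> for the curvature form \<open>F\<close>. As \<open>Z\<close> is a Killing field and
  commutes with itself, \<open>d\<beta>(Z, \<cdot>) = - d(g(Z, Z))\<close>, which matches the correction by which \<open>f\<^sub>1\<close> differs from
  the Hamiltonian \<open>f\<close> of \<open>\<omega>\<^sub>1\<close>. This is what makes the projection along \<open>Z\<^sub>1\<^sup>P\<close> compatible with Lie brackets.\<close>

lemma f1_rep_derivative: "((f1 \<circ> cinv c) has_derivative (\<lambda>v. - curv p (Z p) v)) (at x)"
proof -
  have 1: "((\<lambda>y. form_rep M c \<beta> y (vec_rep M c Z y)) has_derivative
      (\<lambda>w. D\<beta> w (Z p) + g p (Z p) (fderiv (vec_rep M c Z) x w))) (at x)"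
    using has_derivative_linear_family[OF S_open form_beta_linear D\<beta> Z_rep_derivative]
    unfolding at_x by (simp add: \<beta>_def)
  have f': "((f \<circ> cinv c) has_derivative Df p) (at x)"
  proof -
    have "fderiv (f \<circ> cinv c) x = Df p"
      by (rule ext) (simp add: f_rep_derivative[OF S_open(2)] cinv_x)
    then show ?thesis using smooth_on_has_derivative[OF f_rep_smooth S_open(2)] by simp
  qed
  have "((\<lambda>y. (f \<circ> cinv c) y - form_rep M c \<beta> y (vec_rep M c Z y) / 2) has_derivative
      (\<lambda>w. Df p w - (D\<beta> w (Z p) + g p (Z p) (fderiv (vec_rep M c Z) x w)) / 2)) (at x)"
    using has_derivative_diff[OF f' has_derivative_mult_right[OF 1, of "1/2"]] by simp
  then have *: "((f1 \<circ> cinv c) has_derivative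
      (\<lambda>w. Df p w - (D\<beta> w (Z p) + g p (Z p) (fderiv (vec_rep M c Z) x w)) / 2)) (at x)"
  proof (rule has_derivative_transform_within_open[OF _ S_open])
    show "(f \<circ> cinv c) y - form_rep M c \<beta> y (vec_rep M c Z y) / 2 = (f1 \<circ> cinv c) y" if "y \<in> S" for y
      unfolding form_rep_def vec_rep_def \<beta>_def f1_def
      using to_chart_of_chart[OF M_manifold c_atlas(1) cinv_S(1)[OF that]] by simp
  qed
  have "Df p w - (D\<beta> w (Z p) + g p (Z p) (fderiv (vec_rep M c Z) x w)) / 2 = - curv p (Z p) w" for w
  proof -
    have "fderiv (\<lambda>y. bil_rep M c g y (Z p) w) x (Z p) + g p (fderiv (vec_rep M c Z) x (Z p)) w
        + g p (Z p) (fderiv (vec_rep M c Z) x w) = 0"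
      using Z_killing p lie_bilinear_form_in_chart[OF M_manifold p c, of g Z "Z p" w, OF g_bilinear[OF p]] x
      unfolding killing_def by simp
    moreover have "D\<beta> (Z p) w = fderiv (\<lambda>y. bil_rep M c g y (Z p) w) x (Z p) + g p (fderiv (vec_rep M c Z) x (Z p)) w"
      using has_derivative_unique[OF D\<beta> beta_rep_derivative] by metis
    ultimately show ?thesis
      unfolding curv_def ext_d_beta using Z_hamiltonian[OF p, of w] by (simp add: field_simps)
  qed
  then show ?thesis using * by simp
qed

end

end

section \<open>Partial maps of smooth maps on a product\<close>

lemma product_chart:
  assumes A: "smooth_manifold A" and B: "smooth_manifold B"
    and a: "a \<in> atlas A" and b: "b \<in> atlas B"
  defines "c \<equiv> (fst a \<times> fst b, map_prod (snd a) (snd b))"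
  shows "c \<in> atlas (prod_mfd A B)"
    and "x \<in> fst a \<Longrightarrow> y \<in> fst b \<Longrightarrow> cinv c (snd a x, snd b y) = (x, y)"
proof -
  show "c \<in> atlas (prod_mfd A B)" unfolding c_def prod_mfd_def using a b by fastforce
  have "inj_on (snd c) (fst c)"
    unfolding c_def using map_prod_inj_on[OF chart_inj_on[OF A a] chart_inj_on[OF B b]] by simp
  from inv_into_f_f[OF this, of "(x, y)"]
  show "x \<in> fst a \<Longrightarrow> y \<in> fst b \<Longrightarrow> cinv c (snd a x, snd b y) = (x, y)"
    unfolding c_def by simp
qed

lemma product_map_differentiable:
  assumes A: "smooth_manifold A" and B: "smooth_manifold B" and F: "smooth_map_on (prod_mfd A B) C W F"
    and W: "(x, y) \<in> W" and a: "a \<in> atlas A" "x \<in> fst a" and b: "b \<in> atlas B" "y \<in> fst b"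
    and d: "d \<in> atlas C" "F (x, y) \<in> fst d"
  obtains \<Psi> where "\<Psi> differentiable (at (snd a x, snd b y))"
    "\<And>x' y'. x' \<in> fst a \<Longrightarrow> y' \<in> fst b \<Longrightarrow> \<Psi> (snd a x', snd b y') = snd d (F (x', y'))"
proof -
  define c where "c = (fst a \<times> fst b, map_prod (snd a) (snd b))"
  note c = product_chart[OF A B a(1) b(1), folded c_def]
  show thesis
  proof (rule that)
    show "snd d \<circ> F \<circ> cinv c differentiable (at (snd a x, snd b y))"
      by (rule smooth_on_imp_differentiable[OF smooth_map_on_in_charts[OF F c(1) d(1)]])
         (rule image_eqI[of _ _ "(x, y)"], use W a b d in \<open>auto simp: c_def\<close>)
    show "(snd d \<circ> F \<circ> cinv c) (snd a x', snd b y') = snd d (F (x', y'))"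
      if "x' \<in> fst a" "y' \<in> fst b" for x' y'
      using c(2)[OF that] by simp
  qed
qed

text \<open>What is needed of an action or of a local section is the differentiability of its restriction to a
  slice, and an open set on which the restriction stays in a given chart, so that the chain rule can be
  applied.\<close>

lemma first_partial_map:
  assumes A: "smooth_manifold A" and B: "smooth_manifold B" and C: "smooth_manifold C"
    and F: "smooth_map_on (prod_mfd A B) C W F"
    and W: "(x, y) \<in> W" and a: "a \<in> atlas A" "x \<in> fst a" and y: "y \<in> mpoints B"
    and d: "d \<in> atlas C" "F (x, y) \<in> fst d"
  shows "snd d \<circ> (\<lambda>x. F (x, y)) \<circ> cinv a differentiable (at (snd a x))"
    and "openin (mtop A) {x \<in> fst a. (x, y) \<in> W \<and> F (x, y) \<in> fst d}"
proof -
  define b where "b = chart_at B y"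
  note b = chart_at_mem[OF B y, folded b_def]
  obtain \<Psi> where \<Psi>: "\<Psi> differentiable (at (snd a x, snd b y))"
    "\<And>x' y'. x' \<in> fst a \<Longrightarrow> y' \<in> fst b \<Longrightarrow> \<Psi> (snd a x', snd b y') = snd d (F (x', y'))"
    using product_map_differentiable[OF A B F W a b d] by blast
  have "((\<lambda>s. (s, snd b y)) has_derivative (\<lambda>s. (s, 0))) (at (snd a x))"
    by (auto intro!: derivative_eq_intros)
  from has_derivative_compose[OF this] \<Psi>(1)
  obtain L where "((\<lambda>s. \<Psi> (s, snd b y)) has_derivative L) (at (snd a x))"
    unfolding differentiable_def by blast
  then have "((snd d \<circ> (\<lambda>x. F (x, y)) \<circ> cinv a) has_derivative L) (at (snd a x))"
    by (rule has_derivative_transform_within_open[OF _ open_chart_range[OF A a(1)]])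
       (use a b \<Psi>(2) A in auto)
  then show "snd d \<circ> (\<lambda>x. F (x, y)) \<circ> cinv a differentiable (at (snd a x))"
    unfolding differentiable_def by blast
  have "openin (mtop (prod_mfd A B)) {z \<in> W. F z \<in> fst d}"
    by (rule openin_preimage[OF F chart_openin[OF C d(1)]])
  then have V: "openin (prod_topology (mtop A) (mtop B)) {z \<in> W. F z \<in> fst d}"
    by (simp add: prod_mfd_def)
  have "continuous_map (mtop A) (prod_topology (mtop A) (mtop B)) (\<lambda>x. (x, y))"
    using y by (simp add: continuous_map_pairwise o_def)
  from openin_continuous_map_preimage[OF this V]
  have "openin (mtop A) (fst a \<inter> {x \<in> mpoints A. (x, y) \<in> {z \<in> W. F z \<in> fst d}})"
    by (intro openin_Int chart_openin[OF A a(1)])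
  moreover have "fst a \<inter> {x \<in> mpoints A. (x, y) \<in> {z \<in> W. F z \<in> fst d}}
      = {x \<in> fst a. (x, y) \<in> W \<and> F (x, y) \<in> fst d}"
    using chart_subset[OF A a(1)] by auto
  ultimately show "openin (mtop A) {x \<in> fst a. (x, y) \<in> W \<and> F (x, y) \<in> fst d}" by simp
qed

lemma second_partial_map:
  assumes A: "smooth_manifold A" and B: "smooth_manifold B" and C: "smooth_manifold C"
    and F: "smooth_map_on (prod_mfd A B) C W F"
    and W: "(x, y) \<in> W" and b: "b \<in> atlas B" "y \<in> fst b" and x: "x \<in> mpoints A"
    and d: "d \<in> atlas C" "F (x, y) \<in> fst d"
  shows "snd d \<circ> (\<lambda>y. F (x, y)) \<circ> cinv b differentiable (at (snd b y))"
    and "openin (mtop B) {y \<in> fst b. (x, y) \<in> W \<and> F (x, y) \<in> fst d}"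
proof -
  define a where "a = chart_at A x"
  note a = chart_at_mem[OF A x, folded a_def]
  obtain \<Psi> where \<Psi>: "\<Psi> differentiable (at (snd a x, snd b y))"
    "\<And>x' y'. x' \<in> fst a \<Longrightarrow> y' \<in> fst b \<Longrightarrow> \<Psi> (snd a x', snd b y') = snd d (F (x', y'))"
    using product_map_differentiable[OF A B F W a b d] by blast
  have "((\<lambda>s. (snd a x, s)) has_derivative (\<lambda>s. (0, s))) (at (snd b y))"
    by (auto intro!: derivative_eq_intros)
  from has_derivative_compose[OF this] \<Psi>(1)
  obtain L where "((\<lambda>s. \<Psi> (snd a x, s)) has_derivative L) (at (snd b y))"
    unfolding differentiable_def by blast
  then have "((snd d \<circ> (\<lambda>y. F (x, y)) \<circ> cinv b) has_derivative L) (at (snd b y))"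
    by (rule has_derivative_transform_within_open[OF _ open_chart_range[OF B b(1)]])
       (use a b \<Psi>(2) B in auto)
  then show "snd d \<circ> (\<lambda>y. F (x, y)) \<circ> cinv b differentiable (at (snd b y))"
    unfolding differentiable_def by blast
  have "openin (mtop (prod_mfd A B)) {z \<in> W. F z \<in> fst d}"
    by (rule openin_preimage[OF F chart_openin[OF C d(1)]])
  then have V: "openin (prod_topology (mtop A) (mtop B)) {z \<in> W. F z \<in> fst d}"
    by (simp add: prod_mfd_def)
  have "continuous_map (mtop B) (prod_topology (mtop A) (mtop B)) (\<lambda>y. (x, y))"
    using x by (simp add: continuous_map_pairwise o_def)
  from openin_continuous_map_preimage[OF this V]
  have "openin (mtop B) (fst b \<inter> {y \<in> mpoints B. (x, y) \<in> {z \<in> W. F z \<in> fst d}})"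
    by (intro openin_Int chart_openin[OF B b(1)])
  moreover have "fst b \<inter> {y \<in> mpoints B. (x, y) \<in> {z \<in> W. F z \<in> fst d}}
      = {y \<in> fst b. (x, y) \<in> W \<and> F (x, y) \<in> fst d}"
    using chart_subset[OF B b(1)] by auto
  ultimately show "openin (mtop B) {y \<in> fst b. (x, y) \<in> W \<and> F (x, y) \<in> fst d}" by simp
qed

section \<open>The principal bundle and horizontal lifts\<close>

lemma has_derivative_tmap_at:
  assumes M: "smooth_manifold M" and N: "smooth_manifold N" and F: "smooth_map_on M N U F"
    and p: "p \<in> U" and FN: "F p \<in> mpoints N"
  shows "((snd (chart_at N (F p)) \<circ> F \<circ> cinv (chart_at M p)) has_derivative tmap M N F p)
    (at (snd (chart_at M p) p))"
proof -
  have pM: "p \<in> mpoints M" using F p openin_subset unfolding smooth_map_on_def by blast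
  show ?thesis
    using tmap_in_charts[OF M N F p chart_at_mem[OF M pM] chart_at_mem[OF N FN]]
    by (simp add: to_chart_at[OF M pM] to_chart_at[OF N FN])
qed

context hk_bundle
begin

lemma bundle_smooth: "smooth_manifold P" "smooth_manifold G" "smooth_map_on P M (mpoints P) \<pi>"
    "smooth_map_on (prod_mfd P G) P (mpoints P \<times> mpoints G) (\<lambda>(p, h). act p h)"
  and one_G: "\<one>\<^bsub>H\<^esub> \<in> mpoints G"
  and act_one: "p \<in> mpoints P \<Longrightarrow> act p \<one>\<^bsub>H\<^esub> = p"
  and \<pi>_act: "p \<in> mpoints P \<Longrightarrow> h \<in> mpoints G \<Longrightarrow> \<pi> (act p h) = \<pi> p"
  and \<pi>_M: "p \<in> mpoints P \<Longrightarrow> \<pi> p \<in> mpoints M"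
proof -
  show "smooth_manifold P" "smooth_manifold G" "smooth_map_on P M (mpoints P) \<pi>"
    "smooth_map_on (prod_mfd P G) P (mpoints P \<times> mpoints G) (\<lambda>(p, h). act p h)"
    and "p \<in> mpoints P \<Longrightarrow> act p \<one>\<^bsub>H\<^esub> = p"
    and "p \<in> mpoints P \<Longrightarrow> \<pi> p \<in> mpoints M"
    using principal unfolding principal_bundle_def lie_group_def by blast+
  have *: "carrier H = mpoints G"
    using principal unfolding principal_bundle_def lie_group_def by blast
  show "p \<in> mpoints P \<Longrightarrow> h \<in> mpoints G \<Longrightarrow> \<pi> (act p h) = \<pi> p"
    using principal * unfolding principal_bundle_def by simp
  have "group H" using principal unfolding principal_bundle_def lie_group_def by blast
  then show "\<one>\<^bsub>H\<^esub> \<in> mpoints G" using * by (metis group.is_monoid monoid.one_closed)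
qed

lemma d\<pi>_linear: "p \<in> mpoints P \<Longrightarrow> linear (d\<pi> p)"
  by (rule linear_tmap[OF bundle_smooth(1) M_manifold bundle_smooth(3)]) (auto simp: \<pi>_M)

lemma \<eta>_linear: "p \<in> mpoints P \<Longrightarrow> linear (\<eta> p)"
  using \<eta>_smooth unfolding smooth_one_form_def by blast

lemma \<eta>_XP: "p \<in> mpoints P \<Longrightarrow> \<eta> p (XP p) = 1"
  unfolding XP_def by (rule \<eta>_normalised)

text \<open>A local trivialisation provides a smooth local section of \<open>\<pi>\<close> through the given point.\<close>

lemma d\<pi>_surj:
  assumes p: "p \<in> mpoints P"
  shows "\<exists>w. d\<pi> p w = y"
proof -
  note M = M_manifold and P = bundle_smooth(1) and G = bundle_smooth(2)
  obtain U \<tau> where U: "openin (mtop M) U" "\<pi> p \<in> U"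
    and bij: "bij_betw \<tau> {p \<in> mpoints P. \<pi> p \<in> U} (U \<times> mpoints G)"
    and s: "smooth_map_on (prod_mfd M G) P (U \<times> mpoints G) (inv_into {p \<in> mpoints P. \<pi> p \<in> U} \<tau>)"
    and fst_\<tau>: "\<And>p. p \<in> mpoints P \<Longrightarrow> \<pi> p \<in> U \<Longrightarrow> fst (\<tau> p) = \<pi> p"
    using principal[unfolded principal_bundle_def, THEN conjunct2, THEN conjunct2, THEN conjunct2,
        THEN conjunct2, THEN conjunct2, THEN conjunct2, THEN conjunct2, THEN bspec, OF \<pi>_M[OF p]]
    by blast
  define s where "s = inv_into {p \<in> mpoints P. \<pi> p \<in> U} \<tau>"
  (* The pull-back of \<eta>; its second-order part \<eta>(Hj) is symmetric and drops out of dh. *)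
  define h where "h = snd (\<tau> p)"
  have \<tau>p: "\<tau> p = (\<pi> p, h)" using fst_\<tau>[OF p U(2)] unfolding h_def by (metis prod.collapse)
  then have h: "(\<pi> p, h) \<in> U \<times> mpoints G" using bij_betw_apply[OF bij, of p] p U by auto
  have sp: "s (\<pi> p, h) = p" unfolding s_def \<tau>p[symmetric]
    using bij p U by (simp add: bij_betw_def)
  have section_s: "\<pi> (s (m, h)) = m" if "m \<in> U" for m
  proof -
    have mh: "(m, h) \<in> \<tau> ` {p \<in> mpoints P. \<pi> p \<in> U}"
      using bij that h unfolding bij_betw_def by auto
    from inv_into_into[OF this] f_inv_into_f[OF this] show ?thesis
      using fst_\<tau>[of "s (m, h)"] unfolding s_def by auto
  qed
  define a where "a = chart_at M (\<pi> p)"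
  define d where "d = chart_at P p"
  note a = chart_at_mem[OF M \<pi>_M[OF p], folded a_def] and d = chart_at_mem[OF P p, folded d_def]
  have dsp: "s (\<pi> p, h) \<in> fst d" using d sp by simp
  have hG: "h \<in> mpoints G" using h by simp
  note slice = first_partial_map[OF M G P s[folded s_def] h a hG d(1) dsp]
  obtain L where L: "((snd d \<circ> (\<lambda>m. s (m, h)) \<circ> cinv a) has_derivative L) (at (snd a (\<pi> p)))"
    using slice(1) unfolding differentiable_def by blast
  have \<pi>': "((snd a \<circ> \<pi> \<circ> cinv d) has_derivative d\<pi> p) (at (snd d p))"
    using has_derivative_tmap_at[OF P M bundle_smooth(3) p \<pi>_M[OF p]] unfolding a_def d_def .
  have comp: "(((snd a \<circ> \<pi> \<circ> cinv d) \<circ> (snd d \<circ> (\<lambda>m. s (m, h)) \<circ> cinv a)) has_derivative (d\<pi> p \<circ> L))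
      (at (snd a (\<pi> p)))"
    by (rule diff_chain_at[OF L]) (use \<pi>' sp cinv_chart[OF M a] in simp)
  define V where "V = {m \<in> fst a. (m, h) \<in> U \<times> mpoints G \<and> s (m, h) \<in> fst d}"
  have "open (snd a ` V)"
    by (rule open_chart_image[OF M a(1)]) (use slice(2) in \<open>auto simp: V_def\<close>)
  moreover have "snd a (\<pi> p) \<in> snd a ` V" using a h dsp by (auto simp: V_def)
  ultimately have "((\<lambda>x. x) has_derivative (d\<pi> p \<circ> L)) (at (snd a (\<pi> p)))"
    by (rule has_derivative_transform_within_open[OF comp])
       (auto simp: V_def cinv_chart[OF M a(1)] cinv_chart[OF P d(1)] section_s)
  from has_derivative_unique[OF this has_derivative_ident] have "d\<pi> p (L y) = y"
    by (metis comp_apply)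
  then show ?thesis ..
qed

text \<open>\<open>\<pi>\<close> is constant along orbits.\<close>

lemma d\<pi>_XP:
  assumes p: "p \<in> mpoints P"
  shows "d\<pi> p (XP p) = 0"
proof -
  note M = M_manifold and P = bundle_smooth(1) and G = bundle_smooth(2)
  define a where "a = chart_at M (\<pi> p)"
  define b where "b = chart_at G \<one>\<^bsub>H\<^esub>"
  define d where "d = chart_at P p"
  note a = chart_at_mem[OF M \<pi>_M[OF p], folded a_def] and d = chart_at_mem[OF P p, folded d_def]
    and b = chart_at_mem[OF G one_G, folded b_def]
  have mem: "(p, \<one>\<^bsub>H\<^esub>) \<in> mpoints P \<times> mpoints G" "(case (p, \<one>\<^bsub>H\<^esub>) of (p, h) \<Rightarrow> act p h) \<in> fst d"
    using p one_G act_one[OF p] d by auto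
  note slice = second_partial_map[OF P G P bundle_smooth(4) mem(1) b p d(1) mem(2), simplified]
  have act': "((snd d \<circ> act p \<circ> cinv b) has_derivative tmap G P (act p) \<one>\<^bsub>H\<^esub>) (at (snd b \<one>\<^bsub>H\<^esub>))"
    using slice(1) unfolding tmap_def act_one[OF p] b_def[symmetric] d_def[symmetric]
    by (simp add: frechet_derivative_works)
  have \<pi>': "((snd a \<circ> \<pi> \<circ> cinv d) has_derivative d\<pi> p) (at (snd d p))"
    using has_derivative_tmap_at[OF P M bundle_smooth(3) p \<pi>_M[OF p]] unfolding a_def d_def .
  have comp: "(((snd a \<circ> \<pi> \<circ> cinv d) \<circ> (snd d \<circ> act p \<circ> cinv b)) has_derivative
      (d\<pi> p \<circ> tmap G P (act p) \<one>\<^bsub>H\<^esub>)) (at (snd b \<one>\<^bsub>H\<^esub>))"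
    by (rule diff_chain_at[OF act']) (use \<pi>' act_one[OF p] cinv_chart[OF G b] in simp)
  define V where "V = {h \<in> fst b. p \<in> mpoints P \<and> h \<in> mpoints G \<and> act p h \<in> fst d}"
  have "open (snd b ` V)"
    by (rule open_chart_image[OF G b(1)]) (use slice(2) in \<open>auto simp: V_def\<close>)
  moreover have "snd b \<one>\<^bsub>H\<^esub> \<in> snd b ` V" using b p one_G mem(2) by (auto simp: V_def)
  ultimately have "((\<lambda>t. snd a (\<pi> p)) has_derivative (d\<pi> p \<circ> tmap G P (act p) \<one>\<^bsub>H\<^esub>)) (at (snd b \<one>\<^bsub>H\<^esub>))"
    by (rule has_derivative_transform_within_open[OF comp])
       (auto simp: V_def cinv_chart[OF G b(1)] cinv_chart[OF P d(1)] \<pi>_act)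
  from has_derivative_unique[OF this has_derivative_const] show ?thesis
    unfolding XP_def by (metis comp_apply)
qed

text \<open>\<open>(d\<pi>, \<eta>)\<close> maps onto a space of the same dimension, since \<open>\<eta>\<close> can be adjusted by multiples of
  \<open>X\<^sub>P\<close>. Hence it is injective too, and horizontal lifts exist and are unique.\<close>

lemma hlift:
  assumes p: "p \<in> mpoints P"
  shows "\<eta> p (hlift p y) = 0" "d\<pi> p (hlift p y) = y"
proof -
  let ?L = "\<lambda>w. (d\<pi> p w, \<eta> p w)"
  have lin: "linear ?L"
    using d\<pi>_linear[OF p] \<eta>_linear[OF p] by (auto simp: linear_iff)
  have onto: "\<exists>w. ?L w = (y, r)" for y r
  proof -
    obtain w where w: "d\<pi> p w = y" using d\<pi>_surj[OF p] by blast
    have "?L (w + (r - \<eta> p w) *\<^sub>R XP p) = (y, r)"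
      using w d\<pi>_XP[OF p] \<eta>_XP[OF p] d\<pi>_linear[OF p] \<eta>_linear[OF p]
      by (simp add: linear_add linear_scale)
    then show ?thesis ..
  qed
  then have "surj ?L" unfolding surj_def by (metis surj_pair)
  then have inj: "inj ?L" by (rule linear_surj_imp_inj[OF lin])
  have "\<exists>!w. \<eta> p w = 0 \<and> d\<pi> p w = y"
    using onto[of y 0] inj unfolding inj_def by (metis prod.inject)
  from theI'[OF this] show "\<eta> p (hlift p y) = 0" "d\<pi> p (hlift p y) = y"
    unfolding hlift_def by auto
qed

lemma Z1P:
  assumes p: "p \<in> mpoints P"
  shows "d\<pi> p (Z1P p) = Z (\<pi> p)" "\<eta> p (Z1P p) = f1 (\<pi> p)"
  unfolding Z1P_def
  using hlift[OF p] d\<pi>_XP[OF p] \<eta>_XP[OF p] d\<pi>_linear[OF p] \<eta>_linear[OF p]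
  by (simp_all add: linear_add linear_scale)

lemma f1_nonzero: "p \<in> mpoints M \<Longrightarrow> f1 p \<noteq> 0"
  using f1_sign unfolding f1_def by auto

end

section \<open>Projection to the submanifold\<close>

context hk_submanifold
begin

lemma N_P: "q \<in> mpoints N \<Longrightarrow> q \<in> mpoints P" and \<pi>_N: "q \<in> mpoints N \<Longrightarrow> \<pi> q \<in> mpoints M"
  using N_subset \<pi>_M by auto

lemma d\<iota>_linear: "q \<in> mpoints N \<Longrightarrow> linear (d\<iota> q)"
  by (rule linear_tmap[OF N_manifold bundle_smooth(1) N_inclusion]) (auto simp: N_P)

text \<open>The inverse of \<open>Y \<mapsto> Y'\<close> in closed form: subtract from a tangent vector the multiple of \<open>Z\<^sub>1\<^sup>P\<close> that makes
  it horizontal, and project to \<open>M\<close>. Unlike \<open>prime\<close>, it has no choice operator in it, so that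
  it can be differentiated.\<close>

definition unprime :: "'p \<Rightarrow> 'e \<Rightarrow> 'e" where
  "unprime q v = d\<pi> q (d\<iota> q v) - (\<eta> q (d\<iota> q v) / f1 (\<pi> q)) *\<^sub>R Z (\<pi> q)"

lemma unprime_linear: "q \<in> mpoints N \<Longrightarrow> linear (unprime q)"
  by (rule linearI)
     (simp_all add: unprime_def linear_add[OF d\<iota>_linear] linear_add[OF d\<pi>_linear[OF N_P]]
       linear_add[OF \<eta>_linear[OF N_P]] linear_scale[OF d\<iota>_linear] linear_scale[OF d\<pi>_linear[OF N_P]]
       linear_scale[OF \<eta>_linear[OF N_P]] algebra_simps add_divide_distrib scaleR_add_left)

lemma unprime_pr:
  assumes q: "q \<in> mpoints N"
  shows "unprime q (pr q w) = d\<pi> q w - (\<eta> q w / f1 (\<pi> q)) *\<^sub>R Z (\<pi> q)"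
proof -
  obtain v0 a0 where va: "w = d\<iota> q v0 + a0 *\<^sub>R Z1P q"
    and uniq: "\<And>v a. w = d\<iota> q v + a *\<^sub>R Z1P q \<Longrightarrow> v = v0 \<and> a = a0"
    using N_transversal[OF q, of w] by (auto simp: Ex1_def)
  have "pr q w = v0" unfolding pr_def using va uniq by (intro the_equality) blast+
  then have *: "d\<iota> q (pr q w) = w - a0 *\<^sub>R Z1P q" using va by simp
  show ?thesis
    unfolding unprime_def *
    using d\<pi>_linear[OF N_P[OF q]] \<eta>_linear[OF N_P[OF q]] Z1P[OF N_P[OF q]] f1_nonzero[OF \<pi>_N[OF q]]
    by (simp add: linear_diff linear_scale diff_divide_distrib scaleR_diff_left)
qed

lemma unprime_prime: "q \<in> mpoints N \<Longrightarrow> unprime q (prime q y) = y"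
  unfolding prime_def using unprime_pr hlift[OF N_P] by simp

lemma unprime_X: "q \<in> mpoints N \<Longrightarrow> unprime q (X q) = (- 1 / f1 (\<pi> q)) *\<^sub>R Z (\<pi> q)"
  unfolding X_def using unprime_pr d\<pi>_XP[OF N_P] \<eta>_XP[OF N_P] by simp

lemma unprime_inj:
  assumes q: "q \<in> mpoints N"
  shows "inj (unprime q)"
proof (rule linear_surj_imp_inj[OF unprime_linear[OF q]])
  show "surj (unprime q)" using unprime_prime[OF q] by (metis surjI)
qed

lemma prime_unprime: "q \<in> mpoints N \<Longrightarrow> prime q (unprime q v) = v"
  using unprime_inj unprime_prime by (metis injD)

lemma prime_linear: "q \<in> mpoints N \<Longrightarrow> linear (prime q)"
  by (rule linearI; rule injD[OF unprime_inj])
     (auto simp: unprime_prime linear_add[OF unprime_linear] linear_scale[OF unprime_linear])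

lemma X_eq: "q \<in> mpoints N \<Longrightarrow> X q = (- 1 / f1 (\<pi> q)) *\<^sub>R prime q (Z (\<pi> q))"
  using prime_unprime[of q "X q"] by (simp only: unprime_X linear_scale[OF prime_linear])

end

context hk_data
begin

lemma curv_skew:
  assumes p: "p \<in> mpoints M"
  shows "curv p u v = - curv p v u"
proof -
  have "ext_d1 M \<beta> p u v = - ext_d1 M \<beta> p v u"
    unfolding ext_d_beta[OF p refl refl] by simp
  then show ?thesis unfolding curv_def using omega_skew[OF p, of 1 u v] by simp
qed

text \<open>The fields \<open>Z\<close>, \<open>J\<^sub>1 Z\<close>, \<open>J\<^sub>2 Z\<close>, \<open>J\<^sub>3 Z\<close> are pairwise orthogonal, and the square
  lengths of the last three are \<open>- \<epsilon>\<^sub>\<alpha> g(Z, Z) \<noteq> 0\<close>, so the orthogonal projection to their span exists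
  although \<open>g\<close> may be indefinite.\<close>

lemma Dv_orthogonal_decomposition:
  assumes p: "p \<in> mpoints M"
  obtains a0 a1 a2 a3 where
    "y - (a0 *\<^sub>R Z p + a1 *\<^sub>R J 1 p (Z p) + a2 *\<^sub>R J 2 p (Z p) + a3 *\<^sub>R J 3 p (Z p)) \<in> Dh p"
proof -
  define n where "n = g p (Z p) (Z p)"
  have n: "n \<noteq> 0" unfolding n_def by (rule Z_nonnull[OF p])
  note G = g_simps[OF p] and skew = J_skew[OF p] and sq = J_square[OF p] and sym = g_sym[OF p]
  have 0: "g p (J \<alpha> p (Z p)) (Z p) = 0" "g p (Z p) (J \<alpha> p (Z p)) = 0" if "\<alpha> \<in> {1..3}" for \<alpha>
    using skew[OF that, of "Z p" "Z p"] sym[of "Z p" "J \<alpha> p (Z p)"] by auto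
  have 1: "g p (J \<alpha> p (Z p)) (J \<alpha> p (Z p)) = - \<epsilon> \<alpha> * n" if "\<alpha> \<in> {1..3}" for \<alpha>
    using skew[OF that, of "Z p" "J \<alpha> p (Z p)"] sq[OF that] by (simp add: G n_def)
  have J13: "J 1 p (J 3 p v) = \<epsilon> 1 *\<^sub>R J 2 p v" for v
    using sq[of 1 "J 2 p v"] J_product[OF p] by simp
  have J32: "J 3 p (J 2 p v) = \<epsilon> 2 *\<^sub>R J 1 p v" for v
    using J_product[OF p, of "J 2 p v"] sq[of 2 v] J_linear[OF p, of 1] by (simp add: linear_scale)
  have 12: "g p (J 1 p (Z p)) (J 2 p (Z p)) = 0"
    using skew[of 1 "Z p" "J 2 p (Z p)"] J_product[OF p] 0(2)[of 3] by simp
  have 13: "g p (J 1 p (Z p)) (J 3 p (Z p)) = 0"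
    using skew[of 1 "Z p" "J 3 p (Z p)"] J13 0(2)[of 2] by (simp add: G)
  have 32: "g p (J 3 p (Z p)) (J 2 p (Z p)) = 0"
    using skew[of 3 "Z p" "J 2 p (Z p)"] J32 0(2)[of 1] by (simp add: G)
  define r where "r = y - ((g p y (Z p) / n) *\<^sub>R Z p + (- \<epsilon> 1 * g p y (J 1 p (Z p)) / n) *\<^sub>R J 1 p (Z p)
    + (- \<epsilon> 2 * g p y (J 2 p (Z p)) / n) *\<^sub>R J 2 p (Z p) + (- \<epsilon> 3 * g p y (J 3 p (Z p)) / n) *\<^sub>R J 3 p (Z p))"
  have e: "\<epsilon> \<alpha> * (\<epsilon> \<alpha> * t) = t" if "\<alpha> \<in> {1..3}" for \<alpha> t
  proof -
    have "\<epsilon> \<alpha> * \<epsilon> \<alpha> = 1" using that eps_sq unfolding alpha_cases by auto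
    then show ?thesis by (simp flip: mult.assoc)
  qed
  have gen: "g p r w = 0" if "w \<in> {Z p, J 1 p (Z p), J 2 p (Z p), J 3 p (Z p)}" for w
    using that n 0 1[of 1] 1[of 2] 1[of 3] 12 13 32 sym[of "J 1 p (Z p)" "J 2 p (Z p)"]
      sym[of "J 1 p (Z p)" "J 3 p (Z p)"] sym[of "J 3 p (Z p)" "J 2 p (Z p)"] e[of 1] e[of 2] e[of 3]
    by (auto simp: r_def G n_def[symmetric])
  have "linear (g p r)" using g_bilinear[OF p] unfolding bilinear_def by blast
  then have "g p r w = 0" if "w \<in> Dv p" for w
    using linear_eq_0_on_span[of "g p r"] gen that unfolding Dv_def by blast
  then have "r \<in> Dh p" unfolding Dh_def by simp
  then show thesis using that unfolding r_def by blast
qed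

end

context hk_qk_correspondence
begin

text \<open>\<open>J'\<^sub>1\<close> is prescribed separately on \<open>X\<close>, on the images of \<open>J\<^sub>\<beta> Z\<close> and on those of horizontal vectors.
  Since \<open>X\<close> is a multiple of \<open>Z'\<close>, all these rules say that \<open>Y \<mapsto> Y'\<close> carries \<open>J\<^sub>1\<close> to \<open>J'\<^sub>1\<close>; the two
  instances that are not prescribed, for \<open>J\<^sub>1 Z\<close> and \<open>J\<^sub>3 Z\<close>, follow from the squares of \<open>J'\<^sub>1\<close> and \<open>J\<^sub>1\<close>.\<close>

lemma J'_prime:
  assumes q: "q \<in> mpoints N"
  shows "J' 1 q (prime q y) = prime q (J 1 (\<pi> q) y)"
proof -
  define z where "z = Z (\<pi> q)"
  define j where "j \<alpha> = J \<alpha> (\<pi> q)" for \<alpha>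
  note p = \<pi>_N[OF q]
  have linJ': "linear (J' 1 q)"
    using J'_smooth[of 1] q unfolding smooth_endo_field_on_def by simp
  have linj: "linear (j 1)" unfolding j_def using J_linear[OF p, of 1] by simp
  note linP = prime_linear[OF q]
  note L = linear_add[OF linJ'] linear_scale[OF linJ'] linear_add[OF linj] linear_scale[OF linj]
    linear_add[OF linP] linear_scale[OF linP]
  have J'J': "J' 1 q (J' 1 q v) = \<epsilon> 1 *\<^sub>R v" for v using J'_square[of 1 q v] q by simp
  have jj: "j 1 (j 1 v) = \<epsilon> 1 *\<^sub>R v" for v unfolding j_def using J_square[OF p, of 1 v] by simp
  have prod: "j 1 (j 2 v) = j 3 v" for v unfolding j_def by (rule J_product[OF p])
  have 0: "J' 1 q (prime q z) = prime q (j 1 z)"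
  proof -
    have "(- 1 / f1 (\<pi> q)) *\<^sub>R J' 1 q (prime q z) = (- 1 / f1 (\<pi> q)) *\<^sub>R prime q (j 1 z)"
      using J'_X[of 1 q] q unfolding X_eq[OF q] L z_def j_def by simp
    then show ?thesis by (rule scaleR_left_imp_eq[rotated]) (simp add: f1_nonzero[OF p])
  qed
  have 1: "J' 1 q (prime q (j 1 z)) = prime q (j 1 (j 1 z))"
    unfolding 0[symmetric] J'J' jj L ..
  have 2: "J' 1 q (prime q (j 2 z)) = prime q (j 1 (j 2 z))"
    using J'_vertical[of 1 2 3 q] q unfolding prod
    by (simp add: cyclic3_def eps_sq z_def j_def)
  have 3: "J' 1 q (prime q (j 3 z)) = prime q (j 1 (j 3 z))"
    unfolding prod[symmetric] 2[symmetric] J'J' jj L ..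
  obtain a0 a1 a2 a3 where h: "y - (a0 *\<^sub>R z + a1 *\<^sub>R j 1 z + a2 *\<^sub>R j 2 z + a3 *\<^sub>R j 3 z) \<in> Dh (\<pi> q)"
    unfolding z_def j_def using Dv_orthogonal_decomposition[OF p] by metis
  define r where "r = y - (a0 *\<^sub>R z + a1 *\<^sub>R j 1 z + a2 *\<^sub>R j 2 z + a3 *\<^sub>R j 3 z)"
  have 4: "J' 1 q (prime q r) = prime q (j 1 r)"
    using J'_horizontal[of 1 q r] q h unfolding r_def j_def by simp
  have y: "y = r + (a0 *\<^sub>R z + a1 *\<^sub>R j 1 z + a2 *\<^sub>R j 2 z + a3 *\<^sub>R j 3 z)" by (simp add: r_def)
  show ?thesis unfolding j_def[symmetric]
    by (subst (1 2) y) (simp only: L 0 1 2 3 4)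
qed

lemma unprime_J': "q \<in> mpoints N \<Longrightarrow> unprime q (J' 1 q v) = J 1 (\<pi> q) (unprime q v)"
  using J'_prime[of q "unprime q v"] by (simp add: prime_unprime unprime_prime)

lemma J'_linear: "q \<in> mpoints N \<Longrightarrow> linear (J' 1 q)"
  using J'_smooth[of 1] unfolding smooth_endo_field_on_def by simp

section \<open>Integrability\<close>

text \<open>In charts of \<open>M'\<close>, \<open>P\<close> and \<open>M\<close>, let \<open>j\<close> represent the inclusion of \<open>M'\<close> and \<open>k\<close> the bundle projection.
  Then \<open>T\<close>, the representation of \<open>unprime\<close>, is
  \<open>d(k \<circ> j) - a \<otimes> Z\<close> with the one-form \<open>a = \<eta> / f\<^sub>1\<close>, and it intertwines \<open>J'\<^sub>1\<close> with \<open>J\<^sub>1\<close>. From \<open>d\<eta> = F\<close> and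
  \<open>df\<^sub>1 = - F(Z, \<cdot>)\<close> one gets \<open>da(u, v) = F(T u, T v) / f\<^sub>1\<close>, the multiples of \<open>F(Z, \<cdot>)\<close> from both sources
  cancelling each other. This is the situation of \<open>nijenhuis_projected_structure\<close>.\<close>

lemma J'_integrable: "integrable_structure N (J' 1)"
  unfolding integrable_structure_def
proof (intro ballI allI)
  fix q u v assume q: "q \<in> mpoints N"
  note N = N_manifold and P = bundle_smooth(1) and M = M_manifold and p = \<pi>_N[OF q] and qP = N_P[OF q]
  define cN where "cN = chart_at N q"
  define cP where "cP = chart_at P q"
  define cM where "cM = chart_at M (\<pi> q)"
  define x0 where "x0 = snd cN q"
  define y0 where "y0 = snd cP q"
  define z0 where "z0 = snd cM (\<pi> q)"
  note cN = chart_at_mem[OF N q, folded cN_def] and cP = chart_at_mem[OF P qP, folded cP_def]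
    and cM = chart_at_mem[OF M p, folded cM_def]
  define V where "V = {r \<in> fst cN. r \<in> fst cP \<and> \<pi> r \<in> fst cM}"
  define S where "S = snd cN ` V"
  define j where "j = snd cP \<circ> (\<lambda>r. r) \<circ> cinv cN"
  define k where "k = snd cM \<circ> \<pi> \<circ> cinv cP"
  define VP where "VP = {r \<in> fst cP. \<pi> r \<in> fst cM}"
  define SP where "SP = snd cP ` VP"
  have "openin (mtop P) (fst cP \<inter> {r \<in> mpoints P. \<pi> r \<in> fst cM})"
    by (intro openin_Int openin_preimage[OF bundle_smooth(3)] chart_openin P M cP cM)
  moreover have "fst cP \<inter> {r \<in> mpoints P. \<pi> r \<in> fst cM} = VP"
    unfolding VP_def using chart_subset[OF P cP(1)] by auto
  ultimately have VP: "openin (mtop P) VP" by simp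
  have "openin (mtop N) (fst cN \<inter> {r \<in> mpoints N. r \<in> VP})"
    by (intro openin_Int openin_preimage[OF N_inclusion] chart_openin N cN VP)
  moreover have "fst cN \<inter> {r \<in> mpoints N. r \<in> VP} = V"
    unfolding V_def VP_def using chart_subset[OF N cN(1)] by auto
  ultimately have V: "openin (mtop N) V" by simp
  have S: "open S" "x0 \<in> S"
    unfolding S_def x0_def using open_chart_image[OF N cN(1) V] cN cP cM by (auto simp: V_def)
  have SP: "open SP" "y0 \<in> SP"
    unfolding SP_def y0_def using open_chart_image[OF P cP(1) VP] cP cM by (auto simp: VP_def)
  have SE: "\<exists>r\<in>V. x = snd cN r \<and> cinv cN x = r \<and> r \<in> mpoints N \<and> r \<in> mpoints P \<and> \<pi> r \<in> mpoints M
      \<and> r \<in> fst cN \<and> r \<in> fst cP \<and> \<pi> r \<in> fst cM \<and> j x = snd cP r \<and> k (j x) = snd cM (\<pi> r) \<and> j x \<in> SP"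
    if "x \<in> S" for x
    using that cinv_chart[OF N cN(1)] cinv_chart[OF P cP(1)] chart_subset[OF N cN(1)] N_P \<pi>_N
    unfolding S_def V_def VP_def SP_def j_def k_def by auto
  (* The differentials have to be known at all points of S, since they are differentiated below. *)
  have j_deriv: "fderiv j x v = to_chart P cP r (d\<iota> r (of_chart N cN r v))"
    if "r = cinv cN x" "x \<in> S" for x r v
    using SE[OF that(2)] that(1) tmap_in_charts[OF N P N_inclusion _ cN(1) _ cP(1), of r]
      frechet_derivative_at unfolding j_def by metis
  have k_deriv: "fderiv k (j x) w = to_chart M cM (\<pi> r) (d\<pi> r (of_chart P cP r w))"
    if "r = cinv cN x" "x \<in> S" for x r w
    using SE[OF that(2)] that(1) tmap_in_charts[OF P M bundle_smooth(3) _ cP(1) _ cM(1), of r]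
      frechet_derivative_at unfolding k_def by metis

  (* Symmetry of second derivatives needs the set on which smoothness is given: for j this is Sj,
     the domain of the chart representation, which contains S. *)
  define Sj where "Sj = snd cN ` {r \<in> mpoints N \<inter> fst cN. r \<in> fst cP}"
  have "openin (mtop N) (fst cN \<inter> {r \<in> mpoints N. r \<in> fst cP})"
    by (intro openin_Int openin_preimage[OF N_inclusion] chart_openin N cN P cP)
  moreover have "fst cN \<inter> {r \<in> mpoints N. r \<in> fst cP} = {r \<in> mpoints N \<inter> fst cN. r \<in> fst cP}" by auto
  ultimately have Sj: "open Sj" "x0 \<in> Sj"
    unfolding Sj_def x0_def using open_chart_image[OF N cN(1)] cN cP q by auto
  have j_smooth: "smooth_on Sj j"
    unfolding Sj_def j_def by (rule smooth_map_on_in_charts[OF N_inclusion cN(1) cP(1)])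
  have "VP = {r \<in> mpoints P \<inter> fst cP. \<pi> r \<in> fst cM}"
    unfolding VP_def using chart_subset[OF P cP(1)] by auto
  then have k_smooth: "smooth_on SP k"
    unfolding SP_def k_def using smooth_map_on_in_charts[OF bundle_smooth(3) cP(1) cM(1)] by simp
  define Hj where "Hj w v = fderiv (\<lambda>x. fderiv j x v) x0 w" for w v
  define Hk where "Hk w v = fderiv (\<lambda>y. fderiv k y v) y0 w" for w v
  have Hj_sym: "Hj w v = Hj v w" for w v
    unfolding Hj_def by (rule symmetric_second_derivative[OF j_smooth Sj])
  have Hk_sym: "Hk w v = Hk v w" for w v
    unfolding Hk_def by (rule symmetric_second_derivative[OF k_smooth SP])
  have Hj: "((\<lambda>x. fderiv j x v) has_derivative (\<lambda>w. Hj w v)) (at x0)" for v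
    unfolding Hj_def by (rule smooth_on_has_derivative[OF smooth_on_frechet_derivative[OF j_smooth] Sj(2)])
  have Hk: "((\<lambda>y. fderiv k y v) has_derivative (\<lambda>w. Hk w v)) (at y0)" for v
    unfolding Hk_def by (rule smooth_on_has_derivative[OF smooth_on_frechet_derivative[OF k_smooth] SP(2)])

  have r0: "cinv cN x0 = q" unfolding x0_def using cinv_chart[OF N cN] .
  have jx0: "j x0 = y0" unfolding j_def y0_def using r0 by simp
  have kx0: "k y0 = z0" unfolding k_def y0_def z0_def using cinv_chart[OF P cP] by simp
  have at_N: "to_chart N cN q v = v" "of_chart N cN q v = v" for v
    using to_chart_at[OF N q] unfolding cN_def by auto
  have at_P: "to_chart P cP q v = v" "of_chart P cP q v = v" for v
    using to_chart_at[OF P qP] unfolding cP_def by auto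
  have at_M: "to_chart M cM (\<pi> q) v = v" "of_chart M cM (\<pi> q) v = v" for v
    using to_chart_at[OF M p] unfolding cM_def by auto
  have j'0: "fderiv j x0 = d\<iota> q"
    using j_deriv[of q x0] r0 S(2) at_N at_P by auto
  have k'0: "fderiv k y0 = d\<pi> q"
    using k_deriv[of q x0] r0 S(2) at_M at_P jx0 by auto
  have j': "(j has_derivative d\<iota> q) (at x0)"
    using smooth_on_has_derivative[OF j_smooth Sj(2)] unfolding j'0 .
  define \<phi> where "\<phi> w = d\<pi> q (d\<iota> q w)" for w
  have kj': "((\<lambda>x. k (j x)) has_derivative \<phi>) (at x0)"
    using has_derivative_compose[OF j', of k "d\<pi> q"] smooth_on_has_derivative[OF k_smooth SP(2)]
    unfolding jx0 k'0 \<phi>_def[abs_def] by simp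

  (* The second derivative of k \<circ> j; only its symmetry is used, so that it drops out of dT. *)
  define \<Phi> where "\<Phi> w v = Hk (d\<iota> q w) (d\<iota> q v) + d\<pi> q (Hj w v)" for w v
  have \<Phi>: "((\<lambda>x. fderiv k (j x) (fderiv j x v)) has_derivative (\<lambda>w. \<Phi> w v)) (at x0)" for v
  proof -
    have lin: "linear (fderiv k (j x))" if "x \<in> S" for x
      using SE[OF that] smooth_on_linear_derivative[OF k_smooth] by blast
    have d: "((\<lambda>x. fderiv k (j x) b) has_derivative (\<lambda>w. Hk (d\<iota> q w) b)) (at x0)" for b
      using has_derivative_compose[OF j', of "\<lambda>y. fderiv k y b" "\<lambda>w. Hk w b"] Hk unfolding jx0 by simp
    show ?thesis
      using has_derivative_linear_family[OF S lin d Hj] unfolding jx0 k'0 j'0 \<Phi>_def .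
  qed
  define h where "h x v = form_rep P cP \<eta> (j x) (fderiv j x v)" for x v
  define D\<eta> where "D\<eta> w v = fderiv (\<lambda>y. form_rep P cP \<eta> y v) y0 w" for w v
  define Dh where "Dh w v = D\<eta> (d\<iota> q w) (d\<iota> q v) + \<eta> q (Hj w v)" for w v
  have \<eta>_at: "form_rep P cP \<eta> y0 v = \<eta> q v" for v
    unfolding y0_def cP_def by (rule rep_at(3)[OF P qP])
  have h0: "h x0 v = \<eta> q (d\<iota> q v)" for v unfolding h_def jx0 j'0 \<eta>_at ..
  have Dh: "((\<lambda>x. h x v) has_derivative (\<lambda>w. Dh w v)) (at x0)" for v
  proof -
    have lin: "linear (form_rep P cP \<eta> (j x))" if "x \<in> S" for x
      using SE[OF that] by (auto intro!: linear_form_rep[OF P cP(1)] \<eta>_linear simp: cinv_chart[OF P cP(1)])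
    have "((\<lambda>y. form_rep P cP \<eta> y b) has_derivative (\<lambda>w. D\<eta> w b)) (at y0)" for b
      unfolding D\<eta>_def
      by (rule smooth_on_has_derivative[OF smooth_form_rep[OF \<eta>_smooth cP(1)]]) (use cP in \<open>simp add: y0_def\<close>)
    then have d: "((\<lambda>x. form_rep P cP \<eta> (j x) b) has_derivative (\<lambda>w. D\<eta> (d\<iota> q w) b)) (at x0)" for b
      using has_derivative_compose[OF j', of "\<lambda>y. form_rep P cP \<eta> y b" "\<lambda>w. D\<eta> w b"] unfolding jx0 by simp
    show ?thesis
      using has_derivative_linear_family[OF S lin d Hj] unfolding h_def jx0 j'0 \<eta>_at Dh_def .
  qed
  have dh: "Dh u v - Dh v u = curv (\<pi> q) (\<phi> u) (\<phi> v)" for u v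
    unfolding Dh_def \<phi>_def curv_def Hj_sym[of u v]
    using \<eta>_curvature[OF qP, of "d\<iota> q u" "d\<iota> q v"]
      ext_d1_in_chart[OF P qP cP_def, of \<eta> "d\<iota> q u" "d\<iota> q v", OF \<eta>_linear[OF qP]]
    by (simp add: D\<eta>_def y0_def)
  define F where "F = curv (\<pi> q)"
  have F_lin: "linear (F u)" "linear (\<lambda>u. F u v)" for u v
    unfolding F_def by (rule curv_linear[OF p cM_def refl])+
  have F_skew: "F u v = - F v u" for u v
    unfolding F_def by (rule curv_skew[OF p])
  have f1': "((\<lambda>x. (f1 \<circ> cinv cM) (k (j x))) has_derivative (\<lambda>w. - F (Z (\<pi> q)) (\<phi> w))) (at x0)"
    unfolding F_def
    using has_derivative_compose[OF kj', of "f1 \<circ> cinv cM" "\<lambda>w. - curv (\<pi> q) (Z (\<pi> q)) w"]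
      f1_rep_derivative[OF p cM_def z0_def] unfolding jx0 kx0 by simp
  define Zc where "Zc = vec_rep M cM Z"
  define DZ where "DZ = fderiv Zc z0"
  have Zc0: "Zc z0 = Z (\<pi> q)" unfolding Zc_def z0_def cM_def by (rule rep_at(1)[OF M p])
  have DZ: "(Zc has_derivative DZ) (at z0)"
    unfolding Zc_def DZ_def by (rule Z_rep_derivative[OF p cM_def z0_def])
  have Z': "((\<lambda>x. Zc (k (j x))) has_derivative (\<lambda>w. DZ (\<phi> w))) (at x0)"
    using has_derivative_compose[OF kj', of Zc DZ] DZ unfolding jx0 kx0 by simp
  have f10: "(f1 \<circ> cinv cM) (k (j x0)) = f1 (\<pi> q)"
    unfolding jx0 kx0 z0_def using cinv_chart[OF M cM] by simp
  define s where "s = f1 (\<pi> q)"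
  have f1z0: "f1 (cinv cM z0) = s" using f10 unfolding jx0 kx0 s_def by simp
  have s: "s \<noteq> 0" unfolding s_def by (rule f1_nonzero[OF p])

  define T where "T x v = fderiv k (j x) (fderiv j x v) - (h x v / (f1 \<circ> cinv cM) (k (j x))) *\<^sub>R Zc (k (j x))"
    for x v
  have T_unprime: "T x v = to_chart M cM (\<pi> r) (unprime r (of_chart N cN r v))"
    if x: "x \<in> S" and r: "r = cinv cN x" for x r v
  proof -
    have R: "r \<in> fst cP" "\<pi> r \<in> fst cM" "j x = snd cP r" "k (j x) = snd cM (\<pi> r)"
      using SE[OF x] r by auto
    show ?thesis
      unfolding T_def unprime_def j_deriv[OF r x] k_deriv[OF r x] h_def form_rep_def Zc_def vec_rep_def
      using linear_to_chart(1)[OF M cM(1) R(2)] cinv_chart[OF P cP(1) R(1)] cinv_chart[OF M cM(1) R(2)]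
        to_chart_of_chart[OF P cP(1) R(1)]
      by (simp add: R(3) R(4)[unfolded R(3)] linear_diff linear_scale)
  qed
  define a where "a v = \<eta> q (d\<iota> q v) / s" for v
  define DT where "DT w v = \<Phi> w v
      - ((Dh w v / s + a v * F (Z (\<pi> q)) (\<phi> w) / s) *\<^sub>R Z (\<pi> q) + a v *\<^sub>R DZ (\<phi> w))" for w v
  have DT: "((\<lambda>x. T x v) has_derivative (\<lambda>w. DT w v)) (at x0)" for v
  proof -
    have 1: "((\<lambda>x. h x v / (f1 \<circ> cinv cM) (k (j x))) has_derivative
        (\<lambda>w. Dh w v / s + a v * F (Z (\<pi> q)) (\<phi> w) / s)) (at x0)"
      by (rule has_derivative_eq_rhs[OF has_derivative_divide[OF Dh f1']])
         (use s f10 in \<open>auto simp: s_def[symmetric] h0 a_def field_simps\<close>)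
    show ?thesis
      unfolding T_def
      by (rule has_derivative_eq_rhs[OF has_derivative_diff[OF \<Phi> has_derivative_scaleR[OF 1 Z']]])
         (simp add: DT_def fun_eq_iff jx0 kx0 Zc0 h0 f1z0 a_def add.commute)
  qed

  define K where "K x v = endo_rep N cN (J' 1) x v" for x v
  define Jc where "Jc z v = endo_rep M cM (J 1) z v" for z v
  define DK where "DK w v = fderiv (\<lambda>x. K x v) x0 w" for w v
  define DJ where "DJ w v = fderiv (\<lambda>z. Jc z v) z0 w" for w v
  have K0: "K x0 v = J' 1 q v" for v
    unfolding K_def x0_def cN_def by (rule rep_at(2)[OF N q])
  have Jc0: "Jc z0 v = J 1 (\<pi> q) v" for v
    unfolding Jc_def z0_def cM_def by (rule rep_at(2)[OF M p])
  have DK: "((\<lambda>x. K x v) has_derivative (\<lambda>w. DK w v)) (at x0)" for v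
    unfolding K_def DK_def
    by (rule smooth_on_has_derivative[OF smooth_endo_rep[OF N J'_smooth cN(1)]]) (use cN in \<open>auto simp: x0_def\<close>)
  have DJ: "((\<lambda>z. Jc z v) has_derivative (\<lambda>w. DJ w v)) (at z0)" for v
    unfolding Jc_def DJ_def by (rule J_rep_derivative[OF p cM_def z0_def]) simp
  have TK: "T x (K x v) = Jc (k (j x)) (T x v)" if x: "x \<in> S" for x v
  proof -
    define r where "r = cinv cN x"
    have R: "r \<in> mpoints N" "r \<in> fst cN" "\<pi> r \<in> fst cM" "k (j x) = snd cM (\<pi> r)"
      using SE[OF x] r_def by auto
    show ?thesis
      unfolding T_unprime[OF x r_def] K_def Jc_def endo_rep_def
      by (simp add: r_def[symmetric] R(4) cinv_chart[OF M cM(1) R(3)] to_chart_of_chart[OF M cM(1) R(3)]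
        to_chart_of_chart[OF N cN(1) R(2)] unprime_J'[OF R(1)])
  qed
  have T0: "T x0 v = unprime q v" for v
    using T_unprime[OF S(2) r0[symmetric]] by (simp add: at_N at_M)
  have T_lin: "linear (T x)" if x: "x \<in> S" for x
  proof -
    define r where "r = cinv cN x"
    have R: "r \<in> mpoints N" "r \<in> fst cN" "\<pi> r \<in> fst cM"
      using SE[OF x] r_def by auto
    have "linear (to_chart M cM (\<pi> r) \<circ> (unprime r \<circ> of_chart N cN r))"
      by (intro linear_compose linear_to_chart N M cN cM R unprime_linear)
    then show ?thesis by (simp add: o_def T_unprime[OF x r_def, abs_def])
  qed
  have Jc_lin: "linear (Jc (k (j x)))" if x: "x \<in> S" for x
    unfolding Jc_def[abs_def]
    by (rule J_rep_linear[OF p cM_def z0_def]) (use SE[OF x] in auto)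
  have DTK: "DT w (J' 1 q v) + unprime q (DK w v) = DJ (\<phi> w) (unprime q v) + J 1 (\<pi> q) (DT w v)" for w v
  proof -
    have 1: "((\<lambda>x. T x (K x v)) has_derivative (\<lambda>w. DT w (K x0 v) + T x0 (DK w v))) (at x0)"
      by (rule has_derivative_linear_family[OF S T_lin DT DK])
    have d: "((\<lambda>x. Jc (k (j x)) b) has_derivative (\<lambda>w. DJ (\<phi> w) b)) (at x0)" for b
      using has_derivative_compose[OF kj', of "\<lambda>z. Jc z b" "\<lambda>w. DJ w b"] DJ unfolding jx0 kx0 by simp
    have 2: "((\<lambda>x. Jc (k (j x)) (T x v)) has_derivative (\<lambda>w. DJ (\<phi> w) (T x0 v) + Jc (k (j x0)) (DT w v))) (at x0)"
      by (rule has_derivative_linear_family[OF S Jc_lin d DT])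
    have "((\<lambda>x. Jc (k (j x)) (T x v)) has_derivative (\<lambda>w. DT w (K x0 v) + T x0 (DK w v))) (at x0)"
      by (rule has_derivative_transform_within_open[OF 1 S]) (rule TK)
    from has_derivative_unique[OF this 2] show ?thesis
      unfolding K0 T0 jx0 kx0 Jc0 by metis
  qed

  define z where "z = Z (\<pi> q)"
  have \<phi>_T: "\<phi> w = unprime q w + a w *\<^sub>R z" for w
    unfolding \<phi>_def unprime_def a_def z_def s_def by simp
  have dT: "DT u v - DT v u = - (1 / s * F (unprime q u) (unprime q v)) *\<^sub>R z
      - a v *\<^sub>R DZ (unprime q u) + a u *\<^sub>R DZ (unprime q v)" for u v
  proof -
    note FL = linear_add[OF F_lin(1)] linear_scale[OF F_lin(1)] linear_add[OF F_lin(2)] linear_scale[OF F_lin(2)]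
    have Fzz: "F z z = 0" using F_skew[of z z] by simp
    have Fz: "F z (\<phi> w) = F z (unprime q w)" for w
      unfolding \<phi>_T by (simp add: FL Fzz)
    have DhF: "Dh u v = Dh v u + F (unprime q u) (unprime q v) - a v * F z (unprime q u) + a u * F z (unprime q v)"
      using dh[of u v] unfolding F_def[symmetric] \<phi>_T
      by (simp add: FL Fzz F_skew[of "unprime q u" z] algebra_simps)
    have DZ_lin: "linear DZ" using has_derivative_linear[OF DZ] .
    have \<Phi>_sym: "\<Phi> u v = \<Phi> v u" unfolding \<Phi>_def Hk_sym[of "d\<iota> q u"] Hj_sym[of u] ..
    have DZ\<phi>: "DZ (\<phi> w) = DZ (unprime q w) + a w *\<^sub>R DZ z" for w
      unfolding \<phi>_T by (simp add: linear_add[OF DZ_lin] linear_scale[OF DZ_lin])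
    define c where "c = (Dh u v / s + a v * F z (unprime q u) / s) - (Dh v u / s + a u * F z (unprime q v) / s)"
    have "DT u v - DT v u = - c *\<^sub>R z - a v *\<^sub>R DZ (unprime q u) + a u *\<^sub>R DZ (unprime q v)"
      unfolding DT_def z_def[symmetric] Fz \<Phi>_sym DZ\<phi> c_def by (simp add: algebra_simps)
    moreover have "c = 1 / s * F (unprime q u) (unprime q v)"
      unfolding c_def DhF using s by (simp add: field_simps)
    ultimately show ?thesis by simp
  qed
  have "DK (J' 1 q u) v - DK (J' 1 q v) u + J' 1 q (DK v u) - J' 1 q (DK u v) = 0"
  proof (rule nijenhuis_projected_structure[where J = "J 1 (\<pi> q)" and T = "unprime q" and DJ = DJ
        and DT = DT and DZ = DZ and \<phi> = \<phi> and a = a and Z = z and F = F and k = "1 / s" and \<epsilon> = "\<epsilon> 1"])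
    show "linear (J 1 (\<pi> q))" using J_linear[OF p, of 1] by simp
    show "J 1 (\<pi> q) (J 1 (\<pi> q) v) = \<epsilon> 1 *\<^sub>R v" for v using J_square[OF p, of 1] by simp
    show "linear (\<lambda>w. DJ w v)" for v using has_derivative_linear[OF DJ] .
    show "linear DZ" using has_derivative_linear[OF DZ] .
    show "DJ z v = DZ (J 1 (\<pi> q) v) - J 1 (\<pi> q) (DZ v)" for v
      unfolding DJ_def DZ_def Jc_def Zc_def z_def by (rule lie_J1_in_chart[OF p cM_def z0_def])
    show "DJ (J 1 (\<pi> q) u) v - DJ (J 1 (\<pi> q) v) u + J 1 (\<pi> q) (DJ v u) - J 1 (\<pi> q) (DJ u v) = 0" for u v
      unfolding DJ_def Jc_def by (rule J1_integrable[OF p cM_def z0_def])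
    show "F (J 1 (\<pi> q) u) v = - F u (J 1 (\<pi> q) v)" for u v
      unfolding F_def by (rule curv_J1[OF p cM_def z0_def])
    show "F u (r *\<^sub>R v) = r * F u v" for r u v using linear_scale[OF F_lin(1)] by simp
  qed (fact unprime_linear[OF q] unprime_inj[OF q] unprime_J'[OF q] DTK \<phi>_T dT)+
  then show "nijenhuis N (J' 1) q u v = 0"
    unfolding nijenhuis_in_chart[OF N q cN_def, of "J' 1", OF J'_linear[OF q]]
    by (simp add: DK_def K_def x0_def)
qed

end

theorem theorem2:
  fixes e :: real and \<epsilon> :: "nat \<Rightarrow> real"
    and M :: "('m, 'e::euclidean_space) mfd"
    and g :: "'m \<Rightarrow> 'e \<Rightarrow> 'e \<Rightarrow> real"
    and J :: "nat \<Rightarrow> 'm \<Rightarrow> 'e \<Rightarrow> 'e"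
    and f :: "'m \<Rightarrow> real" and Z :: "'m \<Rightarrow> 'e"
    and G :: "('g, real) mfd" and H :: "'g monoid" and \<xi> :: real
    and P :: "('p, 'e \<times> real) mfd" and \<pi> :: "'p \<Rightarrow> 'm"
    and act :: "'p \<Rightarrow> 'g \<Rightarrow> 'p" and \<eta> :: "'p \<Rightarrow> 'e \<times> real \<Rightarrow> real"
    and M' :: "('p, 'e) mfd"
    and J' :: "nat \<Rightarrow> 'p \<Rightarrow> 'e \<Rightarrow> 'e"
    and g' :: "'p \<Rightarrow> 'e \<Rightarrow> 'e \<Rightarrow> real"
    and Q :: "'p \<Rightarrow> ('e \<Rightarrow> 'e) set"
  assumes "hk_qk_correspondence e \<epsilon> M g J f Z G H \<xi> P \<pi> act \<eta> M' J' g' Q"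
    and "eps_quaternionic_kaehler \<epsilon> M' g' Q"
  shows "(\<forall>q\<in>mpoints M'. J' 1 q \<in> Q q) \<and> almost_eps_complex M' (\<epsilon> 1) (J' 1) \<and>
    integrable_structure M' (J' 1)"
proof -
  interpret hk_qk_correspondence e \<epsilon> M g J f Z G H \<xi> P \<pi> act \<eta> M' J' g' Q
    by fact
  have "J' 1 q \<in> Q q" if q: "q \<in> mpoints M'" for q
  proof -
    have "{1..3} = {1, 2, 3 :: nat}" by auto
    then have "J' 1 q = (\<lambda>v. \<Sum>\<alpha>\<in>{1..3}. (if \<alpha> = 1 then 1 else 0) *\<^sub>R J' \<alpha> q v)"
      by simp
    then show ?thesis unfolding Q_eq[OF q] endo_span_def
      by (intro CollectI exI[of _ "\<lambda>\<alpha>. if \<alpha> = 1 then 1 else 0"])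
  qed
  moreover have "dim {v. J' 1 q v = v} = dim {v. J' 1 q v = - v}"
    if e: "\<epsilon> 1 = 1" and q: "q \<in> mpoints M'" for q
  proof -
    have lin: "linear (J' \<alpha> q)" if "\<alpha> \<in> {1..3}" for \<alpha>
      using J'_smooth[OF that] q unfolding smooth_endo_field_on_def by blast
    (* J'\<^sub>2 anticommutes with J'\<^sub>1 and therefore exchanges the two eigenspaces. *)
    have anti: "J' 2 q (J' 1 q v) = - J' 1 q (J' 2 q v)" for v
      unfolding J'_product[OF q]
      by (rule quaternionic_anticommute[of "J' 1 q" "J' 2 q" "\<epsilon> 1" "\<epsilon> 2" "J' 3 q" "\<epsilon> 3"])
         (use lin J'_square J'_product q eps3 eps_nz in auto)
    have inj: "inj (J' 2 q)"
    proof (rule injI)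
      fix v w assume "J' 2 q v = J' 2 q w"
      then have "\<epsilon> 2 *\<^sub>R v = \<epsilon> 2 *\<^sub>R w" using J'_square[of 2 q] q by (metis alpha_cases)
      then show "v = w" using eps_nz by simp
    qed
    have le: "dim A \<le> dim B" if "J' 2 q ` A \<subseteq> B" for A B
    proof -
      have "dim A = dim (J' 2 q ` A)"
        using dim_image_eq[OF lin[of 2], of A] inj by (simp add: inj_on_subset)
      then show ?thesis using dim_subset[OF that] by simp
    qed
    have neg: "J' 2 q (- v) = - J' 2 q v" for v using linear_neg[OF lin[of 2]] by simp
    show ?thesis
    proof (rule antisym; rule le; safe)
      fix v assume v: "J' 1 q v = v"
      show "J' 1 q (J' 2 q v) = - J' 2 q v" using anti[of v] v by (metis minus_minus)
    next
      fix v assume v: "J' 1 q v = - v"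
      show "J' 1 q (J' 2 q v) = J' 2 q v" using anti[of v] v neg[of v] by simp
    qed
  qed
  ultimately show ?thesis
    using J'_integrable J'_smooth[of 1] J'_square[of 1] unfolding almost_eps_complex_def by simp
qed

end
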